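(* Let $\mu$ denote the Möbius function and, for $H\geq 1$, let \[ \Gamma(H)=\sum_{1\leq x,y\leq H}\mu^2(x^2+y^2+1)\,\mu^2(x^2+y^2+2), \] the sum being over pairs of positive integers $x,y\leq H$. For every $\varepsilon>0$ we have, as $H\to\infty$, \[ \Gamma(H)=\sigma H^2+\mathcal{O}\left(H^{\frac{8}{5}+\varepsilon}\right), \] where the implied constant depends only on $\varepsilon$ and \[ \sigma=\prod_{p}\left(1-\frac{\lambda(p^2,1)+\lambda(1,p^2)}{p^4}\right), \] the product being over all primes $p$.
   Context: For positive integers $q_1,q_2$, $\lambda(q_1,q_2)$ denotes the number of pairs of integers $(x,y)$ with $1\leq x,y\leq q_1q_2$, $x^2+y^2+1\equiv 0 \pmod{q_1}$ and $x^2+y^2+2\equiv 0\pmod{q_2}$. In particular $\lambda(p^2,1)$ is the number of pairs $1\leq x,y\leq p^2$ with $x^2+y^2+1\equiv0\pmod{p^2}$, and $\lambda(1,p^2)$ is the number of pairs $1\leq x,y\leq p^2$ with $x^2+y^2+2\equiv 0\pmod{p^2}$. *)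

theory Defs
  imports
    "HOL-Analysis.Analysis"
    "HOL-Library.Landau_Symbols"
    "HOL-Number_Theory.Cong"
    "HOL-Computational_Algebra.Squarefree"
begin

definition moebius_mu :: "nat \<Rightarrow> int" where
  "moebius_mu n = (if squarefree n then (-1) ^ card (prime_factors n) else 0)"

definition lambda_count :: "nat \<Rightarrow> nat \<Rightarrow> nat" where
  "lambda_count q1 q2 =
     card {(x, y). x \<in> {1..q1 * q2} \<and> y \<in> {1..q1 * q2} \<and>
                   [x\<^sup>2 + y\<^sup>2 + 1 = 0] (mod q1) \<and> [x\<^sup>2 + y\<^sup>2 + 2 = 0] (mod q2)}"

(* H is a real parameter; the integers x with 1 \<le> x \<le> H are those in {1..nat \<lfloor>H\<rfloor>}. *)
definition Gamma_sum :: "real \<Rightarrow> int" where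
  "Gamma_sum H =
     (\<Sum>x\<in>{1..nat \<lfloor>H\<rfloor>}. \<Sum>y\<in>{1..nat \<lfloor>H\<rfloor>}.
        (moebius_mu (x\<^sup>2 + y\<^sup>2 + 1))\<^sup>2 * (moebius_mu (x\<^sup>2 + y\<^sup>2 + 2))\<^sup>2)"

(* Factors at non-primes are 1, so the product over all naturals is the product over primes. *)
definition sigma_factor :: "nat \<Rightarrow> real" where
  "sigma_factor p =
     (if prime p
      then 1 - (real (lambda_count (p\<^sup>2) 1) + real (lambda_count 1 (p\<^sup>2))) / real p ^ 4
      else 1)"

definition sigma_const :: real where
  "sigma_const = prodinf sigma_factor"

end

theory Submission
  imports Defs "HOL-Computational_Algebra.Nth_Powers"
begin

text \<open>
  Put \<open>F(x, y) = (x\<^sup>2 + y\<^sup>2 + 1) (x\<^sup>2 + y\<^sup>2 + 2)\<close>.  The two factors are coprime, so the summand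
  is the indicator of \<open>F(x, y)\<close> being squarefree, i.e. the sum of \<open>\<mu>(D)\<close> over all \<open>D\<close> with
  \<open>D\<^sup>2\<close> dividing \<open>F(x, y)\<close>.  Split this sum at \<open>w = H powr (2/5)\<close>.

  For \<open>D \<le> w\<close> the period \<open>D\<^sup>2\<close> is less than \<open>H\<close>, so counting full periods gives the main term
  \<open>H\<^sup>2 L(D\<^sup>2) / D\<^sup>4\<close> with an error \<open>O(H L(D\<^sup>2) / D\<^sup>2)\<close>, where \<open>L(q)\<close> counts the zeros of \<open>F\<close>
  modulo \<open>q\<close>.  By the Chinese remainder theorem \<open>L\<close> is multiplicative, so the main terms form
  the Euler product, and \<open>L(p\<^sup>2) \<le> 8 p\<^sup>2\<close> makes all errors admissible.

  For \<open>D > w\<close> it suffices, by the divisor bound and the bound \<open>n powr \<epsilon>\<close> for the number of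
  representations of \<open>n\<close> as a sum of two squares, to count the integers \<open>s \<le> 2 H\<^sup>2\<close> such that
  \<open>(s + 1) (s + 2)\<close> is divisible by some \<open>D\<^sup>2\<close> with \<open>D > w\<close>.  There are at most
  \<open>H powr (2 + \<epsilon>) / w\<close> of them.
\<close>

subsection \<open>The divisor bound and sums of two squares\<close>

text \<open>Only factors with \<open>p < B\<close> can exceed 1, and there are at most
  \<open>B\<close> of them. The bound does not depend on \<open>A\<close>, which makes the constants
  in the two bounds below uniform in \<open>n\<close>.\<close>

lemma prod_le_power_if_eventually_le_1:
  fixes u :: "nat \<Rightarrow> real"
  assumes fin: "finite A" and nonneg: "\<And>p. p \<in> A \<Longrightarrow> 0 \<le> u p"
    and small: "\<And>p. p \<in> A \<Longrightarrow> u p \<le> C" and large: "\<And>p. p \<in> A \<Longrightarrow> B \<le> p \<Longrightarrow> u p \<le> 1"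
    and C: "1 \<le> C"
  shows "prod u A \<le> C ^ B"
proof -
  have "prod u A \<le> (\<Prod>p\<in>A. if p < B then C else 1)"
    using nonneg small large by (intro prod_mono) auto
  also have "\<dots> = C ^ card (A \<inter> {p. p < B})"
    using fin by (simp add: prod.If_cases)
  also have "\<dots> \<le> C ^ B"
  proof (rule power_increasing[OF _ C])
    have "card (A \<inter> {p. p < B}) \<le> card {..<B}"
      by (intro card_mono) auto
    thus "card (A \<inter> {p. p < B}) \<le> B" by simp
  qed
  finally show ?thesis .
qed

definition divisor_count :: "nat \<Rightarrow> nat" where
  "divisor_count n = card {d. d dvd n}"

lemma divisor_count_le_prod:
  assumes "n > 0"
  shows "divisor_count n \<le> (\<Prod>p\<in>prime_factors n. multiplicity p n + 1)"
proof -
  define h where "h = (\<lambda>d. restrict (\<lambda>p. multiplicity p d) (prime_factors n))"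
  have "divisor_count n \<le> card (\<Pi>\<^sub>E p\<in>prime_factors n. {0..multiplicity p n})"
    unfolding divisor_count_def
  proof (rule card_inj_on_le)
    show "inj_on h {d. d dvd n}"
    proof (rule inj_onI)
      fix a b assume ab: "a \<in> {d. d dvd n}" "b \<in> {d. d dvd n}" "h a = h b"
      show "a = b"
      proof (rule multiplicity_eq_nat)
        show "a > 0" "b > 0" using ab assms by (auto intro!: Nat.gr0I)
        fix p :: nat assume p: "prime p"
        show "multiplicity p a = multiplicity p b"
        proof (cases "p dvd n")
          case True
          hence "p \<in> prime_factors n" using p assms by (simp add: prime_factors_dvd)
          with fun_cong[OF ab(3), of p] show ?thesis by (simp add: h_def)
        next
          case False
          with ab show ?thesis
            by (metis dvd_trans mem_Collect_eq not_dvd_imp_multiplicity_0)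
        qed
      qed
    qed
    show "h ` {d. d dvd n} \<subseteq> (\<Pi>\<^sub>E p\<in>prime_factors n. {0..multiplicity p n})"
      using assms by (auto simp: h_def intro!: dvd_imp_multiplicity_le)
  qed (auto intro!: finite_PiE)
  also have "\<dots> = (\<Prod>p\<in>prime_factors n. multiplicity p n + 1)"
    by (simp add: card_PiE)
  finally show ?thesis .
qed

lemma divisor_count_mono:
  assumes "m dvd n" "n > 0"
  shows "divisor_count m \<le> divisor_count n"
  unfolding divisor_count_def using assms by (intro card_mono) auto

text \<open>The quotient of \<open>divisor_count n\<close> by \<open>n powr \<delta>\<close> is at
  most a product over p dividing n of local factors \<open>(a + 1) / (p ^ a) powr \<delta>\<close>,
  where a is the exponent of p. Each is at most \<open>1 / c\<close>, and at most 1 once p is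
  large.\<close>

lemma divisor_bound:
  fixes \<delta> :: real
  assumes \<delta>: "\<delta> > 0"
  obtains C where "C \<ge> 1" "\<And>n. n > 0 \<Longrightarrow> real (divisor_count n) \<le> C * real n powr \<delta>"
proof
  \<comment> \<open>This choice gives \<open>c * (a + 1) \<le> 1 + a * (\<delta> * ln 2)\<close> for
    all a: \<open>c \<le> 1\<close> settles the constant term and
    \<open>c \<le> \<delta> * ln 2\<close> the linear one.\<close>
  define c where "c = min 1 (\<delta> * ln 2)"
  have c: "0 < c" "c \<le> 1" "c \<le> \<delta> * ln 2" using \<delta> by (auto simp: c_def)
  \<comment> \<open>From here on \<open>p powr \<delta>\<close> is at least 2, so
    \<open>(p ^ a) powr \<delta>\<close> is at least \<open>2 ^ a\<close>, hence at least a +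
    1.\<close>
  define B where "B = nat \<lceil>2 powr (1 / \<delta>)\<rceil>"
  show C: "1 \<le> (1 / c) ^ B" using c by (intro one_le_power) auto
  fix n :: nat assume n: "n > 0"
  define u where "u = (\<lambda>p. real (multiplicity p n + 1) / real (p ^ multiplicity p n) powr \<delta>)"
  have n_eq: "real n powr \<delta> = (\<Prod>p\<in>prime_factors n. real (p ^ multiplicity p n) powr \<delta>)"
    by (subst prime_factorization_nat[OF n]) (simp add: prod_powr_distrib)
  have "real (divisor_count n) \<le> real (\<Prod>p\<in>prime_factors n. multiplicity p n + 1)"
    using divisor_count_le_prod[OF n] by (intro of_nat_mono)
  also have "\<dots> = prod u (prime_factors n) * real n powr \<delta>"
    unfolding n_eq u_def of_nat_prod prod.distrib[symmetric]
    by (intro prod.cong) (auto dest: in_prime_factors_imp_prime prime_gt_0_nat)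
  also have "prod u (prime_factors n) \<le> (1 / c) ^ B"
  proof (rule prod_le_power_if_eventually_le_1)
    fix p assume p: "p \<in> prime_factors n"
    hence p2: "p \<ge> 2" by (auto intro: prime_ge_2_nat)
    define a where "a = multiplicity p n"
    have pw: "real (p ^ a) powr \<delta> = exp (real a * (\<delta> * ln p))"
      using p2 by (simp add: powr_def ln_realpow)
    show "0 \<le> u p" by (simp add: u_def)
    have "c * (real a + 1) \<le> 1 + real a * (\<delta> * ln 2)"
    proof -
      have "real a * c \<le> real a * (\<delta> * ln 2)" using c by (intro mult_left_mono) auto
      thus ?thesis using c by (simp add: algebra_simps)
    qed
    also have "\<dots> \<le> exp (real a * (\<delta> * ln 2))" by (rule exp_ge_add_one_self)
    also have "\<dots> \<le> exp (real a * (\<delta> * ln p))"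
      using p2 \<delta> by (auto intro!: mult_left_mono)
    finally have "c * (real a + 1) \<le> real (p ^ a) powr \<delta>" unfolding pw .
    thus "u p \<le> 1 / c"
      using c p2 by (simp add: u_def a_def[symmetric] field_simps)
    assume "B \<le> p"
    hence "2 powr (1 / \<delta>) \<le> real p" unfolding B_def by linarith
    hence "(2 powr (1 / \<delta>)) powr \<delta> \<le> real p powr \<delta>" using \<delta> by (intro powr_mono2) auto
    hence *: "2 \<le> real p powr \<delta>" using \<delta> by (simp add: powr_powr)
    have "real a + 1 \<le> 2 ^ a"
      using of_nat_mono[OF Suc_leI[OF less_exp[of a]], where 'a = real] by (simp add: add.commute)
    also have "\<dots> \<le> (real p powr \<delta>) ^ a" using * by (intro power_mono) auto
    also have "\<dots> = real (p ^ a) powr \<delta>"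
      using p2 by (simp add: powr_realpow[symmetric] powr_powr mult.commute)
    finally show "u p \<le> 1"
      using p2 by (simp add: u_def a_def[symmetric] field_simps)
  qed (use c in auto)
  finally show "real (divisor_count n) \<le> (1 / c) ^ B * real n powr \<delta>"
    by (simp add: mult_right_mono)
qed

lemma squarefree_eq_prod_prime_factors:
  fixes n :: nat
  assumes sf: "squarefree n"
  shows "\<Prod>(prime_factors n) = n"
proof -
  have n: "n > 0" using sf by (auto intro!: Nat.gr0I)
  have "\<Prod>(prime_factors n) = (\<Prod>p\<in>prime_factors n. p ^ multiplicity p n)"
    using sf n by (intro prod.cong) (auto simp: squarefree_factorial_semiring')
  also have "\<dots> = n" using prime_factorization_nat[OF n] by simp
  finally show ?thesis .
qed

text \<open>Same device as in \<open>divisor_bound\<close>, with local factors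
  \<open>K / p powr \<delta>\<close>: each is at most \<open>K\<close>, and at most 1 once p reaches
  \<open>K powr (1 / \<delta>)\<close>.\<close>

lemma power_omega_bound:
  fixes \<delta> K :: real
  assumes \<delta>: "\<delta> > 0" and K: "K \<ge> 1"
  obtains C where "C \<ge> 1" "\<And>n. squarefree n \<Longrightarrow> K ^ card (prime_factors n) \<le> C * real n powr \<delta>"
proof
  define B where "B = nat \<lceil>K powr (1 / \<delta>)\<rceil>"
  show "1 \<le> K ^ B" using K by simp
  fix n :: nat assume sf: "squarefree n"
  define u where "u = (\<lambda>p::nat. K / real p powr \<delta>)"
  have "real n powr \<delta> = (\<Prod>p\<in>prime_factors n. real p) powr \<delta>"
    by (subst squarefree_eq_prod_prime_factors[OF sf, symmetric]) simp
  also have "\<dots> = (\<Prod>p\<in>prime_factors n. real p powr \<delta>)" by (simp add: prod_powr_distrib)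
  finally have n_eq: "real n powr \<delta> = \<dots>" .
  have "K ^ card (prime_factors n) = prod u (prime_factors n) * real n powr \<delta>"
    unfolding n_eq u_def prod.distrib[symmetric] prod_constant[symmetric]
    by (intro prod.cong) (auto dest: in_prime_factors_imp_prime prime_gt_0_nat)
  also have "prod u (prime_factors n) \<le> K ^ B"
  proof (rule prod_le_power_if_eventually_le_1)
    fix p assume p: "p \<in> prime_factors n"
    hence p2: "p \<ge> 2" by (auto intro: prime_ge_2_nat)
    hence "1 \<le> real p powr \<delta>" using \<delta> by (intro ge_one_powr_ge_zero) auto
    hence "K * 1 \<le> K * real p powr \<delta>" using K by (intro mult_left_mono) auto
    thus "u p \<le> K" using p2 by (simp add: u_def field_simps)
    show "0 \<le> u p" using K by (simp add: u_def)
    assume "B \<le> p"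
    hence "K powr (1 / \<delta>) \<le> real p" unfolding B_def by linarith
    hence "(K powr (1 / \<delta>)) powr \<delta> \<le> real p powr \<delta>" using \<delta> by (intro powr_mono2) auto
    hence "K \<le> real p powr \<delta>" using \<delta> K by (simp add: powr_powr)
    thus "u p \<le> 1" using p2 by (simp add: u_def field_simps)
  qed (use K in auto)
  finally show "K ^ card (prime_factors n) \<le> K ^ B * real n powr \<delta>"
    by (simp add: mult_right_mono)
qed

section \<open>Representations as a sum of two positive squares\<close>

definition two_square_reps :: "nat \<Rightarrow> (nat \<times> nat) set" where
  "two_square_reps s = {(x, y). x > 0 \<and> y > 0 \<and> x\<^sup>2 + y\<^sup>2 = s}"

lemma finite_two_square_reps: "finite (two_square_reps s)"
proof (rule finite_subset)
  show "two_square_reps s \<subseteq> {..s} \<times> {..s}"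
  proof
    fix q assume "q \<in> two_square_reps s"
    then obtain x y where xy: "q = (x, y)" "x\<^sup>2 + y\<^sup>2 = s" by (auto simp: two_square_reps_def)
    have "x \<le> x\<^sup>2" "y \<le> y\<^sup>2" by (simp_all add: self_le_power power2_nat_le_imp_le)
    thus "q \<in> {..s} \<times> {..s}" using xy by auto
  qed
qed auto

text \<open>Fix one representation \<open>(x\<^sub>0, y\<^sub>0)\<close>.  For any other, \<open>s\<close> divides
  \<open>(x y\<^sub>0 - y x\<^sub>0) (x y\<^sub>0 + y x\<^sub>0)\<close>, and the gcd of \<open>s\<close> with the first factor records how
  \<open>s\<close> splits.  If two representations split \<open>s\<close> in the same way, then \<open>s\<close> divides their
  determinant \<open>x\<^sub>1 y\<^sub>2 - x\<^sub>2 y\<^sub>1\<close>, which is smaller than \<open>s\<close> in absolute value and hence zero.\<close>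

lemma coprime_reps_inj:
  fixes s :: nat and x0 y0 :: nat
  assumes rep0: "(x0, y0) \<in> two_square_reps s" and cop0: "coprime x0 y0"
  shows "inj_on (\<lambda>(x, y). nat (gcd (int s) (int x * int y0 - int y * int x0)))
           {(x, y) \<in> two_square_reps s. coprime x y}"
proof (rule inj_onI, clarify)
  fix x1 y1 x2 y2 :: nat
  assume r1: "(x1, y1) \<in> two_square_reps s" "coprime x1 y1"
    and r2: "(x2, y2) \<in> two_square_reps s" "coprime x2 y2"
    and eq: "nat (gcd (int s) (int x1 * int y0 - int y1 * int x0)) =
             nat (gcd (int s) (int x2 * int y0 - int y2 * int x0))"
  define a b x y u v S where "a = int x0" and "b = int y0" and "x = int x1" and "y = int y1"
    and "u = int x2" and "v = int y2" and "S = int s"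
  note defs = a_def b_def x_def y_def u_def v_def S_def
  have pos: "x > 0" "y > 0" "u > 0" "v > 0" "a > 0" "b > 0"
    using r1 r2 rep0 by (auto simp: defs two_square_reps_def)
  have nS0: "x0\<^sup>2 + y0\<^sup>2 = s" "x1\<^sup>2 + y1\<^sup>2 = s" "x2\<^sup>2 + y2\<^sup>2 = s"
    using r1 r2 rep0 by (auto simp: two_square_reps_def)
  have S: "a\<^sup>2 + b\<^sup>2 = S" "x\<^sup>2 + y\<^sup>2 = S" "u\<^sup>2 + v\<^sup>2 = S"
    unfolding defs by (subst nS0[symmetric], simp)+
  have Spos: "S > 0" using S(1) pos by (metis sum_power2_gt_zero_iff less_irrefl)
  have cop: "coprime a b" "coprime x y" "coprime u v"
    using cop0 r1 r2 by (auto simp: defs)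
  define g where "g = gcd S (x * b - y * a)"
  have g2: "g = gcd S (u * b - v * a)"
    using eq unfolding g_def defs by (metis eq_nat_nat_iff gcd_ge_0_int)
  have "S dvd (X * b - Y * a) * (X * b + Y * a)" if "X\<^sup>2 + Y\<^sup>2 = S" for X Y
  proof -
    have "(X * b - Y * a) * (X * b + Y * a) = X\<^sup>2 * (a\<^sup>2 + b\<^sup>2) - (X\<^sup>2 + Y\<^sup>2) * a\<^sup>2"
      by (simp add: power2_eq_square algebra_simps)
    also have "\<dots> = S * (X\<^sup>2 - a\<^sup>2)" by (simp add: S that algebra_simps)
    finally show ?thesis by simp
  qed
  note dv = this
  \<comment> \<open>After division by \<open>gcd S A\<close>, the cofactor of \<open>S\<close> is
    coprime to that of \<open>A\<close>, so it must divide \<open>B\<close>.\<close>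
  have split: "S div gcd S A dvd B" if "S dvd A * B" for A B :: int
  proof -
    have "S div gcd S A dvd (A div gcd S A) * B"
    proof -
      have "S = gcd S A * (S div gcd S A)" "A = gcd S A * (A div gcd S A)" by simp_all
      hence "gcd S A * (S div gcd S A) dvd gcd S A * ((A div gcd S A) * B)"
        using that by (metis mult.assoc)
      thus ?thesis using Spos by (subst (asm) dvd_mult_cancel_left) auto
    qed
    moreover have "coprime (S div gcd S A) (A div gcd S A)"
      using Spos by (intro div_gcd_coprime) auto
    ultimately show ?thesis by (simp add: coprime_dvd_mult_right_iff)
  qed
  have k: "S div g dvd x * b + y * a" "S div g dvd u * b + v * a"
    using split[OF dv[OF S(2)]] split[OF dv[OF S(3)]] by (simp_all add: g_def[symmetric] g2[symmetric])
  have gd: "g dvd x * b - y * a" "g dvd u * b - v * a" by (simp add: g_def) (simp add: g2)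
  have Sg: "S = g * (S div g)" by (simp add: g_def)
  define X where "X = x * v - u * y"
  \<comment> \<open>Each product pairs a multiple of g with a multiple of \<open>S div g\<close>.
    The cross difference collapses to 2abX, and ab is coprime to S because a and b are coprime with
    a^2 + b^2 = S.\<close>
  have "S dvd (x * b - y * a) * (u * b + v * a) - (u * b - v * a) * (x * b + y * a)"
    using gd k Sg by (metis dvd_diff mult_dvd_mono)
  also have "(x * b - y * a) * (u * b + v * a) - (u * b - v * a) * (x * b + y * a) = (a * b) * (2 * X)"
    by (simp add: X_def algebra_simps)
  finally have "S dvd (a * b) * (2 * X)" .
  moreover have "coprime S (a * b)"
  proof -
    have *: "coprime (c\<^sup>2 + d\<^sup>2) c" if "coprime c d" for c d :: int
    proof (rule coprimeI)
      fix e assume e: "e dvd c\<^sup>2 + d\<^sup>2" "e dvd c"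
      hence "e dvd d\<^sup>2" by (simp add: dvd_add_right_iff power2_eq_square)
      moreover have "coprime c (d\<^sup>2)" using that by simp
      ultimately show "is_unit e" using e(2) coprime_common_divisor by blast
    qed
    have "coprime (a\<^sup>2 + b\<^sup>2) a" "coprime (a\<^sup>2 + b\<^sup>2) b"
      using *[OF cop(1)] *[of b a] cop(1) by (simp_all add: add.commute coprime_commute)
    thus ?thesis by (simp add: S)
  qed
  ultimately have S2X: "S dvd 2 * X" by (simp add: coprime_dvd_mult_right_iff)
  have "S dvd X"
  proof (cases "even S")
    case False
    hence "coprime S 2" by simp
    with S2X show ?thesis by (simp add: coprime_dvd_mult_right_iff)
  next
    case True
    have od: "odd X \<and> odd Y" if "coprime X Y" "X\<^sup>2 + Y\<^sup>2 = S" for X Y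
    proof -
      have "even X \<longleftrightarrow> even Y" using True that(2) by (metis even_add even_power pos2)
      moreover have "\<not> (even X \<and> even Y)" using that(1) by (metis coprime_common_divisor odd_one)
      ultimately show ?thesis by blast
    qed
    have "odd x" "odd y" "odd u" "odd v" using od cop S by blast+
    hence "even X" by (simp add: X_def)
    \<comment> \<open>A sum of two odd squares is 2 modulo 4, so S = 2k with k odd. Then k divides X
      by \<open>S2X\<close>, and X is even because all four entries are odd.\<close>
    obtain m n where mn: "x = 2 * m + 1" "y = 2 * n + 1" using \<open>odd x\<close> \<open>odd y\<close> by (auto elim!: oddE)
    have S': "S = 2 * (2 * (m\<^sup>2 + m + n\<^sup>2 + n) + 1)"
      unfolding S(2)[symmetric] mn by (simp add: power2_eq_square algebra_simps)
    then obtain k where k: "S = 2 * k" "odd k"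
      using that[of "2 * (m\<^sup>2 + m + n\<^sup>2 + n) + 1"] by simp
    have "k dvd X" using S2X unfolding k(1) by (subst (asm) dvd_mult_cancel_left) auto
    moreover have "coprime 2 k" using k(2) by simp
    ultimately show ?thesis unfolding k(1) using \<open>even X\<close> by (intro divides_mult)
  qed
  \<comment> \<open>All four entries are positive with squares below S, so both products in X lie
    strictly between 0 and S.\<close>
  moreover have "\<bar>X\<bar> < S"
  proof -
    have lt: "c * d < S" if "c\<^sup>2 < S" "d\<^sup>2 < S" "c > 0" "d > 0" for c d :: int
    proof (cases "c \<le> d")
      case True
      hence "c * d \<le> d * d" using that by (intro mult_right_mono) auto
      also have "\<dots> < S" using that by (simp add: power2_eq_square)
      finally show ?thesis .
    next
      case False
      hence "c * d \<le> c * c" using that by (intro mult_left_mono) auto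
      also have "\<dots> < S" using that by (simp add: power2_eq_square)
      finally show ?thesis .
    qed
    have "x\<^sup>2 < S" "y\<^sup>2 < S" "u\<^sup>2 < S" "v\<^sup>2 < S" using S zero_less_power[OF pos(1), of 2]
      zero_less_power[OF pos(2), of 2] zero_less_power[OF pos(3), of 2] zero_less_power[OF pos(4), of 2]
      by linarith+
    hence "x * v < S" "u * y < S" "x * v > 0" "u * y > 0" using pos by (auto intro: lt)
    thus ?thesis by (simp add: X_def)
  qed
  ultimately have "X = 0" using dvd_imp_le_int[of X S] Spos by auto
  hence X0: "x * v = u * y" by (simp add: X_def)
  \<comment> \<open>A vanishing determinant makes the two vectors proportional; equal norm and
    positivity then make them equal.\<close>
  have "S * v\<^sup>2 = S * y\<^sup>2"
  proof -
    have "S * v\<^sup>2 = (x * v)\<^sup>2 + y\<^sup>2 * v\<^sup>2" unfolding S(2)[symmetric] by (simp add: algebra_simps power_mult_distrib)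
    also have "\<dots> = (u\<^sup>2 + v\<^sup>2) * y\<^sup>2" unfolding X0 by (simp add: algebra_simps power_mult_distrib)
    finally show ?thesis by (simp add: S)
  qed
  hence "v = y" using Spos pos by (simp add: power2_eq_iff)
  moreover from this have "x = u" using X0 pos by simp
  ultimately show "x1 = x2 \<and> y1 = y2" by (simp add: defs)
qed

lemma card_coprime_reps_le:
  assumes "s > 0"
  shows "card {(x, y) \<in> two_square_reps s. coprime x y} \<le> divisor_count s"
proof (cases "{(x, y) \<in> two_square_reps s. coprime x y} = {}")
  case True
  show ?thesis unfolding True by simp
next
  case False
  then obtain x0 y0 where r: "(x0, y0) \<in> two_square_reps s" "coprime x0 y0" by auto
  show ?thesis unfolding divisor_count_def
  proof (rule card_inj_on_le[OF coprime_reps_inj[OF r]])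
    have "nat (gcd (int s) A) dvd s" for A
      by (metis gcd_dvd1 gcd_ge_0_int int_dvd_int_iff nat_0_le)
    thus "(\<lambda>(x, y). nat (gcd (int s) (int x * int y0 - int y * int x0))) `
            {(x, y) \<in> two_square_reps s. coprime x y} \<subseteq> {d. d dvd s}" by auto
  qed (use assms in auto)
qed

text \<open>Pull out e = gcd(x, y): then e^2 divides s, and the rest is a primitive representation
  of s / e^2. The number of choices of e and the number of primitive representations for each e are
  both at most \<open>divisor_count s\<close>.\<close>

lemma card_two_square_reps_le:
  assumes s: "s > 0"
  shows "card (two_square_reps s) \<le> divisor_count s ^ 2"
proof -
  define P where "P = (\<lambda>e. {(x, y) \<in> two_square_reps (s div e\<^sup>2). coprime x y})"
  define E where "E = {e. e\<^sup>2 dvd s}"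
  have Es: "E \<subseteq> {d. d dvd s}" by (auto simp: E_def intro: dvd_trans[rotated])
  have finE: "finite E" using finite_subset[OF Es] s by simp
  have finP: "finite (P e)" for e
    unfolding P_def by (rule finite_subset[OF _ finite_two_square_reps[of "s div e\<^sup>2"]]) auto
  have "two_square_reps s \<subseteq> (\<Union>e\<in>E. (\<lambda>(x, y). (e * x, e * y)) ` P e)"
  proof clarify
    fix x y assume xy: "(x, y) \<in> two_square_reps s"
    hence pos: "x > 0" "y > 0" and sum: "x\<^sup>2 + y\<^sup>2 = s" by (auto simp: two_square_reps_def)
    obtain u v where uv: "x = gcd x y * u" "y = gcd x y * v" "coprime u v"
      using gcd_coprime_exists[of x y] pos by (auto simp: mult.commute)
    define e where "e = gcd x y"
    have e: "e > 0" using pos by (simp add: e_def)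
    have s_eq: "s = e\<^sup>2 * (u\<^sup>2 + v\<^sup>2)"
      unfolding sum[symmetric] by (subst uv(1), subst uv(2)) (simp add: e_def algebra_simps power_mult_distrib)
    have "u > 0" "v > 0" using uv pos by (auto intro!: Nat.gr0I)
    hence "(u, v) \<in> P e" using uv(3) e by (simp add: P_def two_square_reps_def s_eq)
    moreover have "e \<in> E" by (simp add: E_def s_eq)
    ultimately show "(x, y) \<in> (\<Union>e\<in>E. (\<lambda>(x, y). (e * x, e * y)) ` P e)"
      using uv by (force simp: e_def)
  qed
  hence "card (two_square_reps s) \<le> card (\<Union>e\<in>E. (\<lambda>(x, y). (e * x, e * y)) ` P e)"
    using finE finP by (intro card_mono) auto
  also have "\<dots> \<le> (\<Sum>e\<in>E. card ((\<lambda>(x, y). (e * x, e * y)) ` P e))" by (rule card_UN_le[OF finE])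
  also have "\<dots> \<le> (\<Sum>e\<in>E. divisor_count s)"
  proof (rule sum_mono)
    fix e assume "e \<in> E"
    hence d: "s div e\<^sup>2 dvd s" "s div e\<^sup>2 > 0"
      using s by (auto simp: E_def div_greater_zero_iff dest: dvd_imp_le intro: Nat.gr0I)
    have "card ((\<lambda>(x, y). (e * x, e * y)) ` P e) \<le> card (P e)" by (rule card_image_le[OF finP])
    also have "\<dots> \<le> divisor_count (s div e\<^sup>2)" unfolding P_def by (rule card_coprime_reps_le[OF d(2)])
    also have "\<dots> \<le> divisor_count s" using d(1) s by (rule divisor_count_mono)
    finally show "card ((\<lambda>(x, y). (e * x, e * y)) ` P e) \<le> divisor_count s" .
  qed
  also have "\<dots> \<le> divisor_count s ^ 2"
  proof -
    have "card E \<le> divisor_count s" unfolding divisor_count_def using Es s by (intro card_mono) auto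
    thus ?thesis by (simp add: power2_eq_square)
  qed
  finally show ?thesis .
qed

subsection \<open>Moebius sums over square divisors\<close>

lemma prime_set_prod:
  fixes X :: "nat set"
  assumes "finite X" "\<And>p. p \<in> X \<Longrightarrow> prime p"
  shows "prime_factors (\<Prod>X) = X" "squarefree (\<Prod>X)"
proof -
  have "0 \<notin> id ` X" using assms(2) by (auto dest: prime_gt_0_nat)
  hence "prime_factors (prod id X) = \<Union>((prime_factors \<circ> id) ` X)"
    by (rule prime_factors_prod[OF assms(1)])
  also have "\<dots> = X" using assms(2) by (auto simp: prime_prime_factors)
  finally show "prime_factors (\<Prod>X) = X" by simp
  show "squarefree (\<Prod>X)"
    using assms(2) by (intro squarefree_prod_coprime) (auto intro: primes_coprime squarefree_prime)
qed

lemma bij_betw_prime_sets_squarefree: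
  fixes A :: "nat set"
  assumes "finite A" "\<And>p. p \<in> A \<Longrightarrow> prime p"
  shows "bij_betw (\<lambda>X. \<Prod>X) (Pow A) {D. squarefree D \<and> prime_factors D \<subseteq> A}"
proof (rule bij_betw_byWitness[where f' = prime_factors])
  have X: "finite X" "\<forall>p\<in>X. prime p" if "X \<in> Pow A" for X
    using that assms finite_subset by blast+
  show "\<forall>X\<in>Pow A. prime_factors (\<Prod>X) = X"
    using X by (intro ballI prime_set_prod) auto
  show "(\<lambda>X. \<Prod>X) ` Pow A \<subseteq> {D. squarefree D \<and> prime_factors D \<subseteq> A}"
    using X prime_set_prod by fastforce
qed (auto simp: squarefree_eq_prod_prime_factors)

text \<open>Expand the product over subsets X of \<open>A\<close>. Each subset corresponds to the
  squarefree number D = \<open>\<Prod>X\<close>, with sign \<open>moebius_mu D\<close>. Taking h = 1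
  yields the Moebius identity below; taking local densities for h yields the partial Euler products
  of the singular series.\<close>

lemma sum_moebius_prod_eq_prod:
  fixes A :: "nat set" and h :: "nat \<Rightarrow> real"
  assumes "finite A" "\<And>p. p \<in> A \<Longrightarrow> prime p"
  shows "(\<Sum>D | squarefree D \<and> prime_factors D \<subseteq> A.
            real_of_int (moebius_mu D) * (\<Prod>p\<in>prime_factors D. h p)) = (\<Prod>p\<in>A. 1 - h p)"
proof -
  have "(\<Prod>p\<in>A. 1 - h p) = (\<Sum>X\<in>Pow A. (-1) ^ card X * (\<Prod>p\<in>X. h p))"
    using prod_diff_conv_sum[OF assms(1), of "\<lambda>_. 1" h] by simp
  also have "\<dots> = (\<Sum>X\<in>Pow A. real_of_int (moebius_mu (\<Prod>X)) * (\<Prod>p\<in>prime_factors (\<Prod>X). h p))"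
  proof (rule sum.cong)
    fix X assume X: "X \<in> Pow A"
    have "finite X" "\<And>p. p \<in> X \<Longrightarrow> prime p" using X assms finite_subset by blast+
    from prime_set_prod[OF this]
    show "(-1) ^ card X * (\<Prod>p\<in>X. h p) =
          real_of_int (moebius_mu (\<Prod>X)) * (\<Prod>p\<in>prime_factors (\<Prod>X). h p)"
      by (simp add: moebius_mu_def)
  qed simp
  also have "\<dots> = (\<Sum>D | squarefree D \<and> prime_factors D \<subseteq> A.
            real_of_int (moebius_mu D) * (\<Prod>p\<in>prime_factors D. h p))"
    by (rule sum.reindex_bij_betw[OF bij_betw_prime_sets_squarefree[OF assms]])
  finally show ?thesis by simp
qed

lemma squarefree_dvd_iff_prime_factors_subset:
  fixes D m :: nat
  assumes "squarefree D" "m > 0"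
  shows "D dvd m \<longleftrightarrow> prime_factors D \<subseteq> prime_factors m"
proof
  assume "D dvd m"
  thus "prime_factors D \<subseteq> prime_factors m" using assms by (intro dvd_prime_factors) auto
next
  assume sub: "prime_factors D \<subseteq> prime_factors m"
  have D: "D > 0" using assms by (auto intro!: Nat.gr0I)
  show "D dvd m"
  proof (rule multiplicity_le_imp_dvd)
    fix p :: nat assume p: "prime p"
    show "multiplicity p D \<le> multiplicity p m"
    proof (cases "p \<in> prime_factors D")
      case True
      hence "multiplicity p D = 1" using assms D by (simp add: squarefree_factorial_semiring')
      moreover have "multiplicity p m > 0" using True sub by (auto simp: prime_factors_multiplicity)
      ultimately show ?thesis by simp
    next
      case False
      thus ?thesis using p by (simp add: prime_factors_multiplicity)
    qed
  qed (use D in auto)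
qed

text \<open>Let m be the largest number whose square divides n. Then D^2 divides n exactly when D
  divides m, so this is the Moebius sum over the divisors of m, which detects m = 1. The condition
  \<open>n \<le> Q\<close> ensures that the range contains every such D.\<close>

lemma sum_moebius_square_dvd:
  assumes n: "n > 0" and "n \<le> Q"
  shows "(\<Sum>D | D \<in> {1..Q} \<and> D\<^sup>2 dvd n. moebius_mu D) = of_bool (squarefree n)"
proof -
  define m where "m = square_part n"
  have m: "m > 0" using n square_part_0_iff[of n] unfolding m_def by (intro Nat.gr0I) auto
  have sq: "D\<^sup>2 dvd n \<longleftrightarrow> D dvd m" for D by (simp add: m_def dvd_square_part_iff)
  have le: "D \<in> {1..Q}" if "D\<^sup>2 dvd n" for D
  proof -
    have "D \<le> D\<^sup>2" by (simp add: self_le_power power2_nat_le_imp_le)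
    moreover have "D\<^sup>2 \<le> n" using that n by (rule dvd_imp_le)
    moreover have "D > 0" using that n by (auto intro!: Nat.gr0I)
    ultimately show ?thesis using assms by auto
  qed
  have "real_of_int (\<Sum>D | D \<in> {1..Q} \<and> D\<^sup>2 dvd n. moebius_mu D) =
        (\<Sum>D | D \<in> {1..Q} \<and> D\<^sup>2 dvd n. real_of_int (moebius_mu D))" by simp
  also have "\<dots> = (\<Sum>D | squarefree D \<and> prime_factors D \<subseteq> prime_factors m. real_of_int (moebius_mu D))"
    using squarefree_dvd_iff_prime_factors_subset[OF _ m] le sq
    by (intro sum.mono_neutral_right) (auto simp: moebius_mu_def)
  also have "\<dots> = (\<Prod>p\<in>prime_factors m. 0)"
    using sum_moebius_prod_eq_prod[of "prime_factors m" "\<lambda>_. 1"] by auto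
  also have "\<dots> = of_bool (prime_factors m = {})" using card_gt_0_iff[of "prime_factors m"] by (cases "prime_factors m = {}") auto
  also have "prime_factors m = {} \<longleftrightarrow> m = 1"
    using m by (auto simp: prime_factorization_empty_iff)
  also have "m = 1 \<longleftrightarrow> squarefree n"
  proof
    assume "m = 1"
    thus "squarefree n" by (intro squarefreeI) (simp add: sq)
  next
    assume "squarefree n"
    thus "m = 1" using squarefreeD[of n m] by (simp add: sq)
  qed
  finally show ?thesis by (metis of_int_eq_iff of_int_of_bool)
qed

subsection \<open>Local densities\<close>

definition consec_prod :: "nat \<Rightarrow> nat \<Rightarrow> nat" where
  "consec_prod x y = (x\<^sup>2 + y\<^sup>2 + 1) * (x\<^sup>2 + y\<^sup>2 + 2)"

text \<open>For \<open>M = q\<close> this is the zero count L(q) of the overview. The box side is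
  separate from the modulus so that L(q) can be compared with counts in the box of side
  \<open>M\<close>.\<close>

definition pair_count :: "nat \<Rightarrow> nat \<Rightarrow> nat" where
  "pair_count M q = card {(x, y). x \<in> {1..M} \<and> y \<in> {1..M} \<and> q dvd consec_prod x y}"

lemma coprime_plus_1_plus_2_nat: "coprime (n + 1) (n + 2 :: nat)"
  using coprime_Suc_right_nat[of "n + 1"] by simp

lemma squarefree_consec_prod_iff:
  "squarefree (consec_prod x y) \<longleftrightarrow> squarefree (x\<^sup>2 + y\<^sup>2 + 1) \<and> squarefree (x\<^sup>2 + y\<^sup>2 + 2)"
  unfolding consec_prod_def using coprime_plus_1_plus_2_nat[of "x\<^sup>2 + y\<^sup>2"]
  by (blast intro: squarefree_mult_coprime dest: squarefree_multD)

lemma card_square_eq_sum: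
  "card {(x, y). x \<in> {1..M} \<and> y \<in> {1..M} \<and> P x y} = (\<Sum>x\<in>{1..M::nat}. \<Sum>y\<in>{1..M::nat}. of_bool (P x y))"
proof -
  have "{(x, y). x \<in> {1..M} \<and> y \<in> {1..M} \<and> P x y} = ({1..M} \<times> {1..M}) \<inter> {(x, y). P x y}" by auto
  also have "card \<dots> = (\<Sum>z\<in>{1..M} \<times> {1..M}. of_bool (z \<in> {(x, y). P x y}))"
    by (subst sum_of_bool_eq) auto
  also have "\<dots> = (\<Sum>x\<in>{1..M}. \<Sum>y\<in>{1..M}. of_bool (P x y))"
    by (simp only: sum.cartesian_product case_prod_unfold mem_Collect_eq fst_conv snd_conv prod.collapse)
  finally show ?thesis .
qed

lemmas pair_count_eq_sum = card_square_eq_sum[where P = "\<lambda>x y. q dvd consec_prod x y" for q, folded pair_count_def]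

lemma pair_count_mono: "M \<le> M' \<Longrightarrow> pair_count M q \<le> pair_count M' q"
  unfolding pair_count_def
  by (rule card_mono, rule finite_subset[of _ "{1..M'} \<times> {1..M'}"]) auto

lemma dvd_consec_prod_cong:
  assumes "[x = x'] (mod q)" "[y = y'] (mod q)"
  shows "q dvd consec_prod x y \<longleftrightarrow> q dvd consec_prod x' y'"
proof -
  have "[consec_prod x y = consec_prod x' y'] (mod q)"
    unfolding consec_prod_def by (intro cong_mult cong_add cong_pow assms cong_refl)
  thus ?thesis by (rule cong_dvd_iff)
qed

section \<open>Counting zeros in a box by full periods\<close>

lemma sum_periodic:
  fixes g :: "nat \<Rightarrow> 'a :: comm_semiring_1"
  assumes per: "\<And>x. g (x + q) = g x"
  shows "(\<Sum>x\<in>{1..k * q}. g x) = of_nat k * (\<Sum>x\<in>{1..q}. g x)"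
proof (induction k)
  case (Suc k)
  have per': "g (x + k * q) = g x" for x
  proof (induction k)
    case (Suc k)
    have "g (x + Suc k * q) = g (x + k * q + q)" by (simp add: algebra_simps)
    thus ?case by (simp only: per Suc)
  qed simp
  have "{1..Suc k * q} = {1..k * q} \<union> {1 + k * q..q + k * q}" by auto
  hence "(\<Sum>x\<in>{1..Suc k * q}. g x) = (\<Sum>x\<in>{1..k * q}. g x) + (\<Sum>x\<in>{1 + k * q..q + k * q}. g x)"
    by (simp only:) (subst sum.union_disjoint, auto)
  also have "(\<Sum>x\<in>{1 + k * q..q + k * q}. g x) = (\<Sum>x\<in>{1..q}. g (x + k * q))"
    by (rule sum.shift_bounds_cl_nat_ivl)
  also have "\<dots> = (\<Sum>x\<in>{1..q}. g x)" by (simp only: per')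
  finally show ?case using Suc by (simp add: algebra_simps)
qed simp

lemma pair_count_multiple: "pair_count (k * q) q = k\<^sup>2 * pair_count q q"
proof -
  have per: "of_bool (q dvd consec_prod x (y + q)) = (of_bool (q dvd consec_prod x y) :: nat)"
    "of_bool (q dvd consec_prod (x + q) y) = (of_bool (q dvd consec_prod x y) :: nat)" for x y
    using dvd_consec_prod_cong[of x x q "y + q" y] dvd_consec_prod_cong[of "x + q" x q y y]
    by (simp_all add: cong_def)
  have "pair_count (k * q) q = (\<Sum>x\<in>{1..k*q}. k * (\<Sum>y\<in>{1..q}. of_bool (q dvd consec_prod x y)))"
    unfolding pair_count_eq_sum by (intro sum.cong refl) (subst sum_periodic, rule per, simp)
  also have "\<dots> = k * (\<Sum>x\<in>{1..q}. k * (\<Sum>y\<in>{1..q}. of_bool (q dvd consec_prod x y)))"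
    by (subst sum_periodic) (simp_all add: per)
  finally show ?thesis unfolding pair_count_eq_sum by (simp add: power2_eq_square sum_distrib_left mult_ac)
qed

text \<open>Put M between k q and (k + 1) q, where the count is exact. The true count and the main
  term both lie between k^2 L and (k + 1)^2 L. The gap (2k + 1) L is at most 3 (M / q) L because
  \<open>q \<le> M\<close> forces k to be at least 1.\<close>

lemma pair_count_approx:
  assumes q: "0 < q" "q \<le> M"
  shows "\<bar>real (pair_count M q) - (real M / real q)\<^sup>2 * real (pair_count q q)\<bar>
           \<le> 3 * (real M / real q) * real (pair_count q q)"
proof -
  define k where "k = M div q"
  define t where "t = real M / real q"
  define L where "L = real (pair_count q q)"
  have k1: "k \<ge> 1" using q by (simp add: k_def div_greater_zero_iff Suc_le_eq)
  have "k * q \<le> M" by (simp add: k_def)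
  have "M \<le> (k + 1) * q"
    using less_imp_le[OF dividend_less_times_div[OF q(1), of M]] by (simp add: k_def algebra_simps)
  with \<open>k * q \<le> M\<close> have le: "k\<^sup>2 * pair_count q q \<le> pair_count M q" "pair_count M q \<le> (k + 1)\<^sup>2 * pair_count q q"
    using pair_count_mono[of "k * q" M q] pair_count_mono[of M "(k + 1) * q" q]
    by (simp_all only: pair_count_multiple)
  have le': "(real k)\<^sup>2 * L \<le> real (pair_count M q)" "real (pair_count M q) \<le> (real k + 1)\<^sup>2 * L"
    using of_nat_mono[OF le(1), where 'a = real] of_nat_mono[OF le(2), where 'a = real]
    by (simp_all add: L_def add.commute)
  have "real (k * q) \<le> real M" "real M \<le> real ((k + 1) * q)"
    using \<open>k * q \<le> M\<close> \<open>M \<le> (k + 1) * q\<close> of_nat_mono by blast+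
  hence t: "real k \<le> t" "t \<le> real k + 1" using q by (simp_all add: t_def field_simps)
  have L: "L \<ge> 0" by (simp add: L_def)
  have sq: "(real k)\<^sup>2 \<le> t\<^sup>2" "t\<^sup>2 \<le> (real k + 1)\<^sup>2" using t by (auto intro!: power_mono)
  have "(real k)\<^sup>2 * L \<le> t\<^sup>2 * L" "t\<^sup>2 * L \<le> (real k + 1)\<^sup>2 * L"
    using sq L by (auto intro!: mult_right_mono)
  with le' have "\<bar>real (pair_count M q) - t\<^sup>2 * L\<bar> \<le> (real k + 1)\<^sup>2 * L - (real k)\<^sup>2 * L"
    by linarith
  also have "\<dots> = (2 * real k + 1) * L" by (simp add: power2_eq_square algebra_simps)
  also have "\<dots> \<le> (3 * t) * L" using t k1 L by (intro mult_right_mono) auto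
  finally show ?thesis by (simp add: t_def L_def)
qed

section \<open>Multiplicativity of the zero count\<close>

lemma bij_betw_mod_coprime:
  fixes a b :: nat
  assumes ab: "coprime a b" "a > 0" "b > 0"
  shows "bij_betw (\<lambda>x. (x mod a, x mod b)) {..<a * b} ({..<a} \<times> {..<b})"
proof -
  have inj: "inj_on (\<lambda>x. (x mod a, x mod b)) {..<a * b}"
  proof (rule inj_onI)
    fix x y assume xy: "x \<in> {..<a * b}" "y \<in> {..<a * b}" "(x mod a, x mod b) = (y mod a, y mod b)"
    have "[x = y] (mod (a * b))" using xy ab(1) by (intro coprime_cong_mult_nat) (auto simp: cong_def)
    thus "x = y" using xy by (auto intro: cong_less_modulus_unique_nat)
  qed
  \<comment> \<open>Surjectivity follows from injectivity by comparing cardinalities.\<close>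
  have "(\<lambda>x. (x mod a, x mod b)) ` {..<a * b} = {..<a} \<times> {..<b}"
    using ab by (intro card_subset_eq) (auto simp: card_image[OF inj])
  with inj show ?thesis by (simp add: bij_betw_def)
qed

text \<open>Replaces the representative q by 0, so that the range agrees with the values of
  \<open>mod\<close> used in the Chinese remainder bijection.\<close>

lemma pair_count_eq_sum_lessThan:
  assumes "q > 0"
  shows "pair_count q q = (\<Sum>x<q. \<Sum>y<q. of_bool (q dvd consec_prod x y))"
proof -
  have shift: "(\<Sum>x\<in>{1..q}. g x) = (\<Sum>x<q. g x)" if "g q = g 0" for g :: "nat \<Rightarrow> nat"
  proof -
    have "(\<Sum>x<Suc q. g x) = g 0 + (\<Sum>x<q. g (Suc x))" by (rule sum.lessThan_Suc_shift)
    thus ?thesis using that by (simp add: sum.atLeast1_atMost_eq)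
  qed
  have "(\<Sum>y\<in>{1..q}. of_bool (q dvd consec_prod x y)) = (\<Sum>y<q. of_bool (q dvd consec_prod x y) :: nat)" for x
    using dvd_consec_prod_cong[of x x q q 0] by (intro shift) (simp add: cong_def)
  moreover have "(\<Sum>x\<in>{1..q}. \<Sum>y<q. of_bool (q dvd consec_prod x y)) =
                 (\<Sum>x<q. \<Sum>y<q. of_bool (q dvd consec_prod x y) :: nat)"
    using dvd_consec_prod_cong[of q 0 q] by (intro shift) (simp add: cong_def)
  ultimately show ?thesis by (simp add: pair_count_eq_sum)
qed

text \<open>The condition modulo ab is a product of conditions on the residues modulo a and modulo
  b. Applying the Chinese remainder theorem to each coordinate turns the double sum into a fourfold
  sum that factors.\<close>

lemma pair_count_mult_coprime:
  assumes ab: "coprime a b" "a > 0" "b > 0"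
  shows "pair_count (a * b) (a * b) = pair_count a a * pair_count b b"
proof -
  define i :: "nat \<Rightarrow> nat \<Rightarrow> nat \<Rightarrow> nat" where "i = (\<lambda>q x y. of_bool (q dvd consec_prod x y))"
  have crt: "(\<Sum>x<a*b. g (x mod a) (x mod b)) = (\<Sum>u<a. \<Sum>v<b. g u v)" for g :: "nat \<Rightarrow> nat \<Rightarrow> nat"
    using sum.reindex_bij_betw[OF bij_betw_mod_coprime[OF ab], of "\<lambda>(u, v). g u v"]
    by (simp add: sum.cartesian_product)
  have i: "i (a * b) x y = i a (x mod a) (y mod a) * i b (x mod b) (y mod b)" for x y
  proof -
    have "a * b dvd n \<longleftrightarrow> a dvd n \<and> b dvd n" for n
      using ab(1) by (metis divides_mult dvd_mult_left dvd_mult_right)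
    moreover have "q dvd consec_prod (x mod q) (y mod q) \<longleftrightarrow> q dvd consec_prod x y" for q
      by (rule dvd_consec_prod_cong) (auto simp: cong_def)
    ultimately show ?thesis by (simp add: i_def)
  qed
  have "pair_count (a * b) (a * b) = (\<Sum>x<a*b. \<Sum>y<a*b. i (a * b) x y)"
    using ab by (simp add: pair_count_eq_sum_lessThan i_def)
  also have "\<dots> = (\<Sum>x<a*b. \<Sum>u<a. \<Sum>v<b. i a (x mod a) u * i b (x mod b) v)"
    unfolding i by (subst crt) simp
  also have "\<dots> = (\<Sum>u'<a. \<Sum>v'<b. \<Sum>u<a. \<Sum>v<b. i a u' u * i b v' v)"
    by (rule crt)
  also have "\<dots> = (\<Sum>u'<a. \<Sum>v'<b. (\<Sum>u<a. i a u' u) * (\<Sum>v<b. i b v' v))"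
    by (simp only: sum_product)
  also have "\<dots> = (\<Sum>u'<a. \<Sum>u<a. i a u' u) * (\<Sum>v'<b. \<Sum>v<b. i b v' v)"
    by (simp only: sum_product)
  finally show ?thesis using ab by (simp add: pair_count_eq_sum_lessThan i_def)
qed

lemma pair_count_prod_primes:
  fixes X :: "nat set"
  assumes "finite X" "\<And>p. p \<in> X \<Longrightarrow> prime p"
  shows "pair_count ((\<Prod>X)\<^sup>2) ((\<Prod>X)\<^sup>2) = (\<Prod>p\<in>X. pair_count (p\<^sup>2) (p\<^sup>2))"
  using assms
proof (induction X rule: finite_induct)
  case empty
  show ?case by (simp add: pair_count_def)
next
  case (insert p X)
  have "coprime p (\<Prod>X)"
    using insert by (intro prod_coprime_right) (auto intro!: primes_coprime)
  moreover have "p > 0" "\<Prod>X > 0" using insert by (auto intro!: prod_pos dest: prime_gt_0_nat)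
  ultimately have "pair_count (p\<^sup>2 * (\<Prod>X)\<^sup>2) (p\<^sup>2 * (\<Prod>X)\<^sup>2) =
      pair_count (p\<^sup>2) (p\<^sup>2) * pair_count ((\<Prod>X)\<^sup>2) ((\<Prod>X)\<^sup>2)"
    by (intro pair_count_mult_coprime) auto
  thus ?case using insert by (simp add: power_mult_distrib)
qed

lemma pair_count_squarefree:
  assumes "squarefree D"
  shows "pair_count (D\<^sup>2) (D\<^sup>2) = (\<Prod>p\<in>prime_factors D. pair_count (p\<^sup>2) (p\<^sup>2))"
proof -
  have "pair_count ((\<Prod>(prime_factors D))\<^sup>2) ((\<Prod>(prime_factors D))\<^sup>2) =
      (\<Prod>p\<in>prime_factors D. pair_count (p\<^sup>2) (p\<^sup>2))"
    by (rule pair_count_prod_primes) auto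
  thus ?thesis by (simp only: squarefree_eq_prod_prime_factors[OF assms])
qed

section \<open>Zero counts modulo squares of primes\<close>

lemma pair_count_prime_square:
  assumes p: "prime p"
  shows "pair_count (p\<^sup>2) (p\<^sup>2) = lambda_count (p\<^sup>2) 1 + lambda_count 1 (p\<^sup>2)"
proof -
  \<comment> \<open>The two consecutive factors are coprime, so p divides at most one of them and
    all of p^2 must fall on the other.\<close>
  have dv: "p\<^sup>2 dvd (s + 1) * (s + 2) \<longleftrightarrow> p\<^sup>2 dvd s + 1 \<or> p\<^sup>2 dvd s + 2" for s
  proof
    assume *: "p\<^sup>2 dvd (s + 1) * (s + 2)"
    have "\<not> (p dvd s + 1 \<and> p dvd s + 2)"
      using coprime_plus_1_plus_2_nat[of s] p by (metis coprime_common_divisor not_prime_unit)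
    hence "coprime (p\<^sup>2) (s + 1) \<or> coprime (p\<^sup>2) (s + 2)"
      using p by (auto simp: prime_imp_coprime)
    thus "p\<^sup>2 dvd s + 1 \<or> p\<^sup>2 dvd s + 2"
      using * by (metis coprime_dvd_mult_left_iff coprime_dvd_mult_right_iff)
  qed (metis dvd_mult dvd_mult2)
  define S where "S = (\<lambda>a. {(x, y). x \<in> {1..p\<^sup>2} \<and> y \<in> {1..p\<^sup>2} \<and> p\<^sup>2 dvd x\<^sup>2 + y\<^sup>2 + a})"
  have fin: "finite (S a)" for a
    by (rule finite_subset[of _ "{1..p\<^sup>2} \<times> {1..p\<^sup>2}"]) (auto simp: S_def)
  have disj: "S 1 \<inter> S 2 = {}"
  proof -
    have "\<not> (p\<^sup>2 dvd s + 1 \<and> p\<^sup>2 dvd s + 2)" for s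
      using coprime_plus_1_plus_2_nat[of s] p
      by (metis coprime_common_divisor is_unit_power_iff not_prime_unit zero_neq_numeral)
    thus ?thesis unfolding S_def by blast
  qed
  have "pair_count (p\<^sup>2) (p\<^sup>2) = card (S 1 \<union> S 2)"
    unfolding pair_count_def consec_prod_def dv S_def by (rule arg_cong[where f = card]) auto
  also have "\<dots> = card (S 1) + card (S 2)" by (rule card_Un_disjoint[OF fin fin disj])
  finally show ?thesis by (simp add: lambda_count_def S_def cong_0_iff)
qed

text \<open>For two solutions y and z, p^2 divides (y - z)(y + z). As p is odd and does not divide
  y, p cannot divide both factors, so y is z or -z modulo p^2.\<close>

lemma card_square_roots_le_2:
  fixes p c :: nat
  assumes p: "prime p" "p > 2"
  shows "card {y \<in> {1..p\<^sup>2}. \<not> p dvd y \<and> p\<^sup>2 dvd c + y\<^sup>2} \<le> 2" (is "card ?A \<le> 2")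
proof (cases "?A = {}")
  case False
  then obtain z where z: "z \<in> {1..p\<^sup>2}" "\<not> p dvd z" "p\<^sup>2 dvd c + z\<^sup>2" by auto
  have "?A \<subseteq> {z, p\<^sup>2 - z}"
  proof
    fix y assume y: "y \<in> ?A"
    have "int (p\<^sup>2) dvd int (c + y\<^sup>2) - int (c + z\<^sup>2)"
      using y z(3) by (intro dvd_diff) (simp_all only: int_dvd_int_iff mem_Collect_eq)
    also have "int (c + y\<^sup>2) - int (c + z\<^sup>2) = (int y - int z) * (int y + int z)"
      by (simp add: power2_eq_square algebra_simps)
    finally have dv: "(int p)\<^sup>2 dvd (int y - int z) * (int y + int z)" by simp
    have "\<not> (int p dvd int y - int z \<and> int p dvd int y + int z)"
    proof
      assume "int p dvd int y - int z \<and> int p dvd int y + int z"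
      hence "int p dvd (int y - int z) + (int y + int z)" using dvd_add by blast
      hence "int p dvd int (2 * y)" by simp
      hence "p dvd 2 * y" by (simp only: int_dvd_int_iff)
      hence "p dvd 2 \<or> p dvd y" using p by (simp add: prime_dvd_mult_iff)
      thus False using y p by (auto dest: dvd_imp_le)
    qed
    hence "coprime ((int p)\<^sup>2) (int y - int z) \<or> coprime ((int p)\<^sup>2) (int y + int z)"
      using p by (auto simp: prime_imp_coprime)
    hence "(int p)\<^sup>2 dvd int y - int z \<or> (int p)\<^sup>2 dvd int y + int z"
      using dv by (auto simp: coprime_dvd_mult_left_iff coprime_dvd_mult_right_iff)
    thus "y \<in> {z, p\<^sup>2 - z}"
    proof
      assume *: "(int p)\<^sup>2 dvd int y - int z"
      have "1 \<le> y" "y \<le> p\<^sup>2" "1 \<le> z" "z \<le> p\<^sup>2" using y z(1) by auto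
      hence "\<bar>int y - int z\<bar> < int (p\<^sup>2)" by linarith
      moreover have "int (p\<^sup>2) \<le> \<bar>int y - int z\<bar>" if "int y - int z \<noteq> 0"
        using dvd_imp_le_int[OF that *] by simp
      ultimately show ?thesis by auto
    next
      assume "(int p)\<^sup>2 dvd int y + int z"
      hence "int (p\<^sup>2) dvd int (y + z)" by simp
      hence dv2: "p\<^sup>2 dvd y + z" by (simp only: int_dvd_int_iff)
      \<comment> \<open>Since p does not divide y, the endpoint is excluded; hence y + z < 2 p^2,
        and p^2 is the only positive multiple left.\<close>
      have "y \<noteq> p\<^sup>2" using y by auto
      hence lt: "0 < y + z" "y + z < p\<^sup>2 * 2" using y z(1) by auto
      obtain k where k: "y + z = p\<^sup>2 * k" using dv2 unfolding dvd_def by blast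
      have "k \<noteq> 0" using lt(1) k by (intro notI) simp
      moreover have "k < 2" using lt(2) unfolding k by (simp only: mult_less_cancel1)
      ultimately have "k = 1" by linarith
      hence "y + z = p\<^sup>2" using k by simp
      thus ?thesis by auto
    qed
  qed
  hence "card ?A \<le> card {z, p\<^sup>2 - z}" by (intro card_mono) auto
  also have "\<dots> \<le> 2" by (simp add: card_insert_if)
  finally show ?thesis .
qed (simp only: card.empty)

text \<open>For odd p, x and y cannot both be divisible by p, since p would then divide a. The
  solutions with p not dividing y number at most two for each x; swapping the coordinates covers the
  others. For p = 2 the trivial bound 16 is already 4 p^2.\<close>

lemma card_two_squares_mod_prime_square_le:
  fixes a p :: nat
  assumes p: "prime p" and a: "a \<in> {1, 2}"
  shows "card {(x, y). x \<in> {1..p\<^sup>2} \<and> y \<in> {1..p\<^sup>2} \<and> p\<^sup>2 dvd x\<^sup>2 + y\<^sup>2 + a} \<le> 4 * p\<^sup>2"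
    (is "card ?S \<le> _")
proof (cases "p = 2")
  case True
  have "card ?S \<le> card ({1..p\<^sup>2} \<times> {1..p\<^sup>2})" by (rule card_mono) auto
  thus ?thesis by (simp add: True)
next
  case False
  hence p2: "p > 2" using prime_ge_2_nat[OF p] by simp
  define R where "R = (\<lambda>x. {y \<in> {1..p\<^sup>2}. \<not> p dvd y \<and> p\<^sup>2 dvd (x\<^sup>2 + a) + y\<^sup>2})"
  define T where "T = Sigma {1..p\<^sup>2} R"
  have cT: "card T \<le> 2 * p\<^sup>2"
  proof -
    have "card T = (\<Sum>x\<in>{1..p\<^sup>2}. card (R x))" unfolding T_def by (rule card_SigmaI) (auto simp: R_def)
    also have "\<dots> \<le> (\<Sum>x\<in>{1..p\<^sup>2}. 2)" unfolding R_def by (intro sum_mono card_square_roots_le_2 p p2)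
    finally show ?thesis by simp
  qed
  have finT: "finite T" by (auto simp: T_def R_def)
  have "?S \<subseteq> T \<union> prod.swap ` T"
  proof clarify
    fix x y assume xy: "x \<in> {1..p\<^sup>2}" "y \<in> {1..p\<^sup>2}" "p\<^sup>2 dvd x\<^sup>2 + y\<^sup>2 + a" "(x, y) \<notin> prod.swap ` T"
    have dv: "p\<^sup>2 dvd (x\<^sup>2 + a) + y\<^sup>2" "p\<^sup>2 dvd (y\<^sup>2 + a) + x\<^sup>2" using xy(3) by (simp_all add: ac_simps)
    have "\<not> (p dvd x \<and> p dvd y)"
    proof
      assume "p dvd x \<and> p dvd y"
      hence "p dvd x\<^sup>2 + y\<^sup>2" by (simp add: power2_eq_square)
      moreover have "p dvd x\<^sup>2 + y\<^sup>2 + a" using xy(3) by (metis dvd_trans dvd_triv_left power2_eq_square)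
      ultimately have "p dvd a" by (simp add: dvd_add_right_iff)
      thus False using p2 a by (auto dest: dvd_imp_le)
    qed
    moreover have "p dvd x"
    proof (rule ccontr)
      assume "\<not> p dvd x"
      hence "(y, x) \<in> T" using xy dv by (auto simp: T_def R_def)
      thus False using xy(4) by force
    qed
    ultimately show "(x, y) \<in> T" using xy dv by (auto simp: T_def R_def)
  qed
  hence "card ?S \<le> card (T \<union> prod.swap ` T)" using finT by (intro card_mono) auto
  also have "\<dots> \<le> card T + card (prod.swap ` T)" by (rule card_Un_le)
  also have "\<dots> \<le> 4 * p\<^sup>2" using cT card_image_le[OF finT, of prod.swap] by linarith
  finally show ?thesis .
qed

lemma pair_count_prime_square_le:
  assumes p: "prime p"
  shows "pair_count (p\<^sup>2) (p\<^sup>2) \<le> 8 * p\<^sup>2"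
  unfolding pair_count_prime_square[OF p]
  using card_two_squares_mod_prime_square_le[OF p, of 1] card_two_squares_mod_prime_square_le[OF p, of 2]
  by (simp add: lambda_count_def cong_0_iff)

text \<open>By multiplicativity the count is at most D^2 times 8 to the number of primes dividing D,
  and \<open>power_omega_bound\<close> absorbs the latter.\<close>

lemma pair_count_bound:
  fixes \<delta> :: real
  assumes "\<delta> > 0"
  obtains C where "C \<ge> 1"
    "\<And>D. squarefree D \<Longrightarrow> real (pair_count (D\<^sup>2) (D\<^sup>2)) \<le> C * real D powr \<delta> * (real D)\<^sup>2"
proof -
  obtain C where C: "C \<ge> 1" "\<And>n. squarefree n \<Longrightarrow> 8 ^ card (prime_factors n) \<le> C * real n powr \<delta>"
    using power_omega_bound[OF assms, of 8] by auto
  show ?thesis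
  proof (rule that[OF C(1)])
    fix D :: nat assume D: "squarefree D"
    have "pair_count (D\<^sup>2) (D\<^sup>2) \<le> (\<Prod>p\<in>prime_factors D. 8 * p\<^sup>2)"
      unfolding pair_count_squarefree[OF D] by (intro prod_mono conjI pair_count_prime_square_le) auto
    also have "\<dots> = 8 ^ card (prime_factors D) * (\<Prod>(prime_factors D))\<^sup>2"
      by (simp add: prod.distrib prod_power_distrib)
    finally have "real (pair_count (D\<^sup>2) (D\<^sup>2)) \<le> real (8 ^ card (prime_factors D) * D\<^sup>2)"
      unfolding squarefree_eq_prod_prime_factors[OF D] by (rule of_nat_mono)
    also have "\<dots> \<le> C * real D powr \<delta> * (real D)\<^sup>2"
      using C(2)[OF D] by (simp add: mult_right_mono)
    finally show "real (pair_count (D\<^sup>2) (D\<^sup>2)) \<le> C * real D powr \<delta> * (real D)\<^sup>2" .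
  qed
qed

subsection \<open>Large square divisors\<close>

text \<open>Split d^(\<delta>-2) as d^(2\<delta>-1) d^(-1-\<delta>). The first exponent is negative,
  so that factor is largest at w; the second factor is summable. Arbitrary finite \<open>A\<close>
  lets one constant serve truncated sums and the tail of the singular series alike.\<close>

lemma powr_tail_bound:
  fixes \<delta> :: real
  assumes \<delta>: "0 < \<delta>" "\<delta> < 1 / 2"
  obtains K where "K \<ge> 0"
    "\<And>(w :: real) A. w > 0 \<Longrightarrow> finite A \<Longrightarrow> (\<And>d. d \<in> A \<Longrightarrow> w < real d) \<Longrightarrow>
       (\<Sum>d\<in>A. real d powr (\<delta> - 2)) \<le> K * w powr (2 * \<delta> - 1)"
proof
  define K where "K = (\<Sum>n. real n powr (-1 - \<delta>))"
  have summ: "summable (\<lambda>n. real n powr (-1 - \<delta>))"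
    using \<delta> by (subst summable_real_powr_iff) auto
  show "K \<ge> 0" unfolding K_def by (intro suminf_nonneg summ) auto
  fix w :: real and A :: "nat set"
  assume w: "w > 0" and fin: "finite A" and A: "\<And>d. d \<in> A \<Longrightarrow> w < real d"
  have "(\<Sum>d\<in>A. real d powr (\<delta> - 2)) \<le> (\<Sum>d\<in>A. w powr (2 * \<delta> - 1) * real d powr (-1 - \<delta>))"
  proof (rule sum_mono)
    fix d assume d: "d \<in> A"
    have "real d powr (\<delta> - 2) = real d powr (2 * \<delta> - 1) * real d powr (-1 - \<delta>)"
      by (simp flip: powr_add)
    also have "real d powr (2 * \<delta> - 1) \<le> w powr (2 * \<delta> - 1)"
      using A[OF d] w \<delta> by (intro powr_mono2') auto
    finally show "real d powr (\<delta> - 2) \<le> w powr (2 * \<delta> - 1) * real d powr (-1 - \<delta>)"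
      by (simp add: mult_right_mono)
  qed
  also have "\<dots> = w powr (2 * \<delta> - 1) * (\<Sum>d\<in>A. real d powr (-1 - \<delta>))"
    by (simp add: sum_distrib_left)
  also have "(\<Sum>d\<in>A. real d powr (-1 - \<delta>)) \<le> K"
    unfolding K_def by (intro sum_le_suminf summ fin) auto
  finally show "(\<Sum>d\<in>A. real d powr (\<delta> - 2)) \<le> K * w powr (2 * \<delta> - 1)"
    by (simp add: mult_left_mono mult.commute[of K])
qed

lemma card_congruent_le:
  fixes A :: "nat set"
  assumes q: "q > 0" and A: "A \<subseteq> {..X}" and cong: "\<And>s t. s \<in> A \<Longrightarrow> t \<in> A \<Longrightarrow> [s = t] (mod q)"
  shows "real (card A) \<le> real X / real q + 1"
proof -
  have "card A \<le> card {..X div q}"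
  proof (rule card_inj_on_le)
    show "inj_on (\<lambda>s. s div q) A"
    proof (rule inj_onI)
      fix s t assume st: "s \<in> A" "t \<in> A" "s div q = t div q"
      thus "s = t" using cong[OF st(1,2)] unfolding cong_def by (metis div_mult_mod_eq)
    qed
    show "(\<lambda>s. s div q) ` A \<subseteq> {..X div q}" using A by (auto intro!: div_le_mono)
  qed simp
  hence "real (card A) \<le> real (X div q) + 1" by simp
  also have "real (X div q) \<le> real X / real q" by (rule of_nat_div_le_of_nat)
  finally show ?thesis by simp
qed

text \<open>As \<open>j > 0\<close>, each s + j is a positive multiple of q, so the quotients start
  at 1 and the extra + 1 of \<open>card_congruent_le\<close> does not arise.\<close>

lemma card_multiples_shift_le:
  assumes q: "q > 0" and j: "j > 0"
  shows "real (card {s \<in> {1..X}. q dvd s + j}) \<le> real (X + j) / real q"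
proof -
  have "card {s \<in> {1..X}. q dvd s + j} \<le> card {1..(X + j) div q}"
  proof (rule card_inj_on_le)
    show "inj_on (\<lambda>s. (s + j) div q) {s \<in> {1..X}. q dvd s + j}"
      using q by (intro inj_onI) (auto elim!: dvdE)
    show "(\<lambda>s. (s + j) div q) ` {s \<in> {1..X}. q dvd s + j} \<subseteq> {1..(X + j) div q}"
      using q j by (auto simp: div_greater_zero_iff Suc_le_eq dest: dvd_imp_le intro!: div_le_mono)
  qed simp
  hence "real (card {s \<in> {1..X}. q dvd s + j}) \<le> real ((X + j) div q)" by simp
  also have "\<dots> \<le> real (X + j) / real q" by (rule of_nat_div_le_of_nat)
  finally show ?thesis .
qed

section \<open>Square divisors of a product of consecutive integers\<close>

lemma square_dvd_coprime_mult_split: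
  fixes D a b :: nat
  assumes D: "D\<^sup>2 dvd a * b" "D > 0" and cop: "coprime a b"
  obtains d e where "D = d * e" "d\<^sup>2 dvd a" "e\<^sup>2 dvd b"
proof -
  \<comment> \<open>The factors u and v are coprime and their product is a square, so each is itself
    a square.\<close>
  obtain u v where uv: "D\<^sup>2 = u * v" "u dvd a" "v dvd b"
    using division_decomp[OF D(1)] by blast
  have "coprime u v" using cop uv by (meson coprime_divisors)
  moreover have "u > 0" "v > 0" using uv(1) D(2) by (metis gr0I mult_is_0 power_not_zero less_irrefl)+
  moreover have "is_nth_power 2 (u * v)" by (simp flip: uv(1))
  ultimately obtain d e where de: "u = d\<^sup>2" "v = e\<^sup>2"
    using is_nth_power_mult_coprime_natD[of u v 2] by (auto elim!: is_nth_powerE)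
  hence "D\<^sup>2 = (d * e)\<^sup>2" using uv(1) by (simp add: power_mult_distrib)
  hence "D = d * e" by (simp add: power2_eq_iff_nonneg)
  thus ?thesis using that uv de by auto
qed

text \<open>Here s stands for x^2 + y^2. Counting values s instead of pairs makes the problem
  one-dimensional; the pairs are recovered from the bound on representations.\<close>

definition exceptional_norms :: "nat \<Rightarrow> real \<Rightarrow> nat set" where
  "exceptional_norms X w = {s \<in> {1..X}. \<exists>D::nat. w < real D \<and> D\<^sup>2 dvd (s + 1) * (s + 2)}"

text \<open>Each splitting D = d e prescribes s = -1 modulo d^2 and s = -2 modulo e^2, which is at
  most one class modulo D^2. The number of splittings is \<open>divisor_count D\<close>.\<close>

lemma card_square_dvd_consec_le:
  assumes D: "D > 0"
  shows "real (card {s \<in> {1..X}. D\<^sup>2 dvd (s + 1) * (s + 2)}) \<le>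
           real (divisor_count D) * (real X / (real D)\<^sup>2 + 1)"
proof -
  define P where "P = (\<lambda>d. {s \<in> {1..X}. d\<^sup>2 dvd s + 1 \<and> (D div d)\<^sup>2 dvd s + 2})"
  have fin: "finite (P d)" for d by (simp add: P_def)
  have finD: "finite {d. d dvd D}" using D by simp
  have "{s \<in> {1..X}. D\<^sup>2 dvd (s + 1) * (s + 2)} \<subseteq> (\<Union>d\<in>{d. d dvd D}. P d)"
  proof
    fix s assume s: "s \<in> {s \<in> {1..X}. D\<^sup>2 dvd (s + 1) * (s + 2)}"
    hence "D\<^sup>2 dvd (s + 1) * (s + 2)" by blast
    then obtain d e where de: "D = d * e" "d\<^sup>2 dvd s + 1" "e\<^sup>2 dvd s + 2"
      using square_dvd_coprime_mult_split[OF _ D coprime_plus_1_plus_2_nat] by metis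
    hence "s \<in> P d" using s D by (simp add: P_def)
    moreover have "d dvd D" using de(1) by simp
    ultimately show "s \<in> (\<Union>d\<in>{d. d dvd D}. P d)" by blast
  qed
  hence "card {s \<in> {1..X}. D\<^sup>2 dvd (s + 1) * (s + 2)} \<le> card (\<Union>d\<in>{d. d dvd D}. P d)"
    using fin finD by (intro card_mono) auto
  also have "\<dots> \<le> (\<Sum>d\<in>{d. d dvd D}. card (P d))" by (rule card_UN_le[OF finD])
  finally have "real (card {s \<in> {1..X}. D\<^sup>2 dvd (s + 1) * (s + 2)}) \<le> (\<Sum>d\<in>{d. d dvd D}. real (card (P d)))"
    unfolding of_nat_sum[symmetric] by (rule of_nat_mono)
  also have "\<dots> \<le> (\<Sum>d\<in>{d. d dvd D}. real X / (real D)\<^sup>2 + 1)"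
  proof (rule sum_mono)
    fix d assume "d \<in> {d. d dvd D}"
    then obtain e where e: "D = d * e" by auto
    hence pos: "d > 0" "e > 0" using D by auto
    have "real (card (P d)) \<le> real X / real (D\<^sup>2) + 1"
    proof (rule card_congruent_le)
      fix s t assume st: "s \<in> P d" "t \<in> P d"
      have ds: "d\<^sup>2 dvd s + 1" "e\<^sup>2 dvd s + 2" and dt: "d\<^sup>2 dvd t + 1" "e\<^sup>2 dvd t + 2"
        using st pos by (simp_all add: P_def e)
      \<comment> \<open>Coprimality comes from the element s itself: the two squares divide
        consecutive integers.\<close>
      have "coprime (d\<^sup>2) (e\<^sup>2)" using ds coprime_plus_1_plus_2_nat[of s] by (meson coprime_divisors)
      moreover have "[s + 1 = t + 1] (mod d\<^sup>2)" using ds(1) dt(1) by (simp only: cong_def mod_0_imp_dvd dvd_imp_mod_0)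
      hence "[s = t] (mod d\<^sup>2)" by (simp only: cong_add_rcancel_nat)
      moreover have "[s + 2 = t + 2] (mod e\<^sup>2)" using ds(2) dt(2) by (simp only: cong_def mod_0_imp_dvd dvd_imp_mod_0)
      hence "[s = t] (mod e\<^sup>2)" by (simp only: cong_add_rcancel_nat)
      ultimately show "[s = t] (mod D\<^sup>2)"
        unfolding e power_mult_distrib by (intro coprime_cong_mult_nat)
    qed (use D in \<open>auto simp: P_def\<close>)
    thus "real (card (P d)) \<le> real X / (real D)\<^sup>2 + 1" by simp
  qed
  also have "\<dots> = real (divisor_count D) * (real X / (real D)\<^sup>2 + 1)" by (simp add: divisor_count_def)
  finally show ?thesis .
qed

text \<open>Write \<open>D = d e\<close> with \<open>d\<^sup>2\<close> dividing \<open>s + 1\<close> and \<open>e\<^sup>2\<close> dividing \<open>s + 2\<close>.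
  If \<open>d\<close> or \<open>e\<close> exceeds \<open>w\<close>, that single divisibility is already rare; otherwise \<open>D \<le> w\<^sup>2\<close>
  is small enough for the \<open>+ 1\<close> in the count of residue classes to be harmless.\<close>

lemma card_exceptional_norms_le:
  fixes w T :: real
  assumes M: "M \<ge> 1" and w: "w \<ge> 1" and T: "\<And>D. 0 < D \<Longrightarrow> real D \<le> w\<^sup>2 \<Longrightarrow> real (divisor_count D) \<le> T"
  shows "real (card (exceptional_norms (2 * M\<^sup>2) w)) \<le>
     8 * (real M)\<^sup>2 * (\<Sum>d | d \<in> {1..2 * M} \<and> w < real d. 1 / (real d)\<^sup>2) +
     T * (2 * (real M)\<^sup>2 * (\<Sum>D | D \<in> {1..nat \<lfloor>w\<^sup>2\<rfloor>} \<and> w < real D. 1 / (real D)\<^sup>2) + w\<^sup>2)"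
proof -
  define X where "X = 2 * M\<^sup>2"
  define I where "I = {d. d \<in> {1..2 * M} \<and> w < real d}"
  define J where "J = {D. D \<in> {1..nat \<lfloor>w\<^sup>2\<rfloor>} \<and> w < real D}"
  define P where "P = (\<lambda>j d. {s \<in> {1..X}. d\<^sup>2 dvd s + j})"
  define Q where "Q = (\<lambda>D. {s \<in> {1..X}. D\<^sup>2 dvd (s + 1) * (s + 2)})"
  have fin: "finite I" "finite J" "finite (P j d)" "finite (Q d)" for j d
    by (simp_all add: I_def J_def P_def Q_def)
  have "exceptional_norms X w \<subseteq> ((\<Union>d\<in>I. P 1 d) \<union> (\<Union>d\<in>I. P 2 d)) \<union> (\<Union>D\<in>J. Q D)"
  proof
    fix s assume "s \<in> exceptional_norms X w"
    then obtain D where s: "s \<in> {1..X}" "w < real D" and Ds: "D\<^sup>2 dvd (s + 1) * (s + 2)"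
      unfolding exceptional_norms_def by blast
    have D: "D > 0" using s(2) w by auto
    obtain d e where de: "D = d * e" "d\<^sup>2 dvd s + 1" "e\<^sup>2 dvd s + 2"
      using square_dvd_coprime_mult_split[OF Ds D coprime_plus_1_plus_2_nat] by metis
    \<comment> \<open>A square dividing s + 1 or s + 2 is at most 2 M^2 + 2, hence at most (2 M)^2.
      This is where the range of \<open>I\<close> comes from.\<close>
    have I: "c \<in> I" if "w < real c" "c\<^sup>2 dvd s + j" "j \<in> {1, 2}" for c j
    proof -
      have "c\<^sup>2 \<le> s + j" using that s by (intro dvd_imp_le) auto
      also have "\<dots> \<le> 2 * M\<^sup>2 + 2" using s that by (auto simp: X_def)
      also have "\<dots> \<le> (2 * M)\<^sup>2" using M by (simp add: power2_eq_square)
      finally have "c \<le> 2 * M" by (rule power2_le_imp_le) simp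
      thus ?thesis using that w by (auto simp: I_def)
    qed
    show "s \<in> ((\<Union>d\<in>I. P 1 d) \<union> (\<Union>d\<in>I. P 2 d)) \<union> (\<Union>D\<in>J. Q D)"
    proof (cases "w < real d \<or> w < real e")
      case True
      thus ?thesis using I[of d 1] I[of e 2] de s(1) by (auto simp: P_def)
    next
      case False
      hence "real d * real e \<le> w * w" using w by (intro mult_mono) auto
      hence "real D \<le> w\<^sup>2" by (simp add: de(1) power2_eq_square)
      hence "D \<le> nat \<lfloor>w\<^sup>2\<rfloor>" by (simp add: le_nat_floor)
      hence "D \<in> J" using s D by (auto simp: J_def)
      moreover have "s \<in> Q D" using s(1) Ds unfolding Q_def by blast
      ultimately show ?thesis by blast
    qed
  qed
  hence "card (exceptional_norms X w) \<le> card (((\<Union>d\<in>I. P 1 d) \<union> (\<Union>d\<in>I. P 2 d)) \<union> (\<Union>D\<in>J. Q D))"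
    using fin by (intro card_mono) auto
  also have "\<dots> \<le> card ((\<Union>d\<in>I. P 1 d) \<union> (\<Union>d\<in>I. P 2 d)) + card (\<Union>D\<in>J. Q D)"
    by (rule card_Un_le)
  also have "card ((\<Union>d\<in>I. P 1 d) \<union> (\<Union>d\<in>I. P 2 d)) \<le> card (\<Union>d\<in>I. P 1 d) + card (\<Union>d\<in>I. P 2 d)"
    by (rule card_Un_le)
  also have "card (\<Union>d\<in>I. P 1 d) \<le> (\<Sum>d\<in>I. card (P 1 d))" by (rule card_UN_le[OF fin(1)])
  also have "card (\<Union>d\<in>I. P 2 d) \<le> (\<Sum>d\<in>I. card (P 2 d))" by (rule card_UN_le[OF fin(1)])
  also have "card (\<Union>D\<in>J. Q D) \<le> (\<Sum>D\<in>J. card (Q D))" by (rule card_UN_le[OF fin(2)])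
  finally have "card (exceptional_norms X w) \<le>
      (\<Sum>d\<in>I. card (P 1 d)) + (\<Sum>d\<in>I. card (P 2 d)) + (\<Sum>D\<in>J. card (Q D))" by simp
  hence le: "real (card (exceptional_norms X w)) \<le>
      (\<Sum>d\<in>I. real (card (P 1 d))) + (\<Sum>d\<in>I. real (card (P 2 d))) + (\<Sum>D\<in>J. real (card (Q D)))"
    unfolding of_nat_sum[symmetric] of_nat_add[symmetric] by (rule of_nat_mono)
  have P: "(\<Sum>d\<in>I. real (card (P j d))) \<le> 4 * (real M)\<^sup>2 * (\<Sum>d\<in>I. 1 / (real d)\<^sup>2)" if j: "j \<in> {1, 2}" for j
    unfolding sum_distrib_left
  proof (rule sum_mono)
    fix d assume d: "d \<in> I"
    have "real (card (P j d)) \<le> real (X + j) / real (d\<^sup>2)"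
      unfolding P_def using d j by (intro card_multiples_shift_le) (auto simp: I_def)
    also have "\<dots> \<le> (4 * (real M)\<^sup>2) / real (d\<^sup>2)"
    proof (rule divide_right_mono)
      have "1 \<le> M\<^sup>2" using M by simp
      hence "X + j \<le> 4 * M\<^sup>2" using j unfolding X_def by auto
      hence "real (X + j) \<le> real (4 * M\<^sup>2)" by (rule of_nat_mono)
      thus "real (X + j) \<le> 4 * (real M)\<^sup>2" by simp
    qed simp
    finally show "real (card (P j d)) \<le> 4 * (real M)\<^sup>2 * (1 / (real d)\<^sup>2)" by simp
  qed
  have T0: "T \<ge> 0" using T[of 1] w by (simp add: order_trans[OF of_nat_0_le_iff])
  have "(\<Sum>D\<in>J. real (card (Q D))) \<le> (\<Sum>D\<in>J. T * (2 * (real M)\<^sup>2 * (1 / (real D)\<^sup>2) + 1))"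
  proof (rule sum_mono)
    fix D assume D: "D \<in> J"
    hence D0: "D > 0" and "D \<le> nat \<lfloor>w\<^sup>2\<rfloor>" by (auto simp: J_def)
    hence "real D \<le> real (nat \<lfloor>w\<^sup>2\<rfloor>)" by simp
    also have "\<dots> \<le> w\<^sup>2" by simp
    finally have "real D \<le> w\<^sup>2" .
    have "real (card (Q D)) \<le> real (divisor_count D) * (real X / (real D)\<^sup>2 + 1)"
      unfolding Q_def by (rule card_square_dvd_consec_le[OF D0])
    also have "\<dots> \<le> T * (real X / (real D)\<^sup>2 + 1)"
      using T[OF D0 \<open>real D \<le> w\<^sup>2\<close>] by (intro mult_right_mono) auto
    finally show "real (card (Q D)) \<le> T * (2 * (real M)\<^sup>2 * (1 / (real D)\<^sup>2) + 1)"
      by (simp add: X_def)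
  qed
  also have "\<dots> = T * (2 * (real M)\<^sup>2 * (\<Sum>D\<in>J. 1 / (real D)\<^sup>2) + real (card J))"
    by (simp add: sum_distrib_left sum.distrib distrib_left)
  also have "\<dots> \<le> T * (2 * (real M)\<^sup>2 * (\<Sum>D\<in>J. 1 / (real D)\<^sup>2) + w\<^sup>2)"
  proof (intro mult_left_mono add_left_mono T0)
    have "card J \<le> card {1..nat \<lfloor>w\<^sup>2\<rfloor>}" by (rule card_mono) (auto simp: J_def)
    hence "real (card J) \<le> real (nat \<lfloor>w\<^sup>2\<rfloor>)" by (simp only: card_atLeastAtMost diff_Suc_1 of_nat_le_iff)
    also have "\<dots> \<le> w\<^sup>2" by simp
    finally show "real (card J) \<le> w\<^sup>2" .
  qed
  finally have Q: "(\<Sum>D\<in>J. real (card (Q D))) \<le> \<dots>" .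
  from le P[of 1] P[of 2] Q show ?thesis
    unfolding I_def[symmetric] J_def[symmetric] X_def[symmetric] by simp
qed

lemma consec_prod_pos: "0 < consec_prod x y"
  by (simp add: consec_prod_def)

text \<open>Supplies the cutoff for D in the Moebius sums that follow.\<close>

lemma consec_prod_le:
  assumes "x \<in> {1..M}" "y \<in> {1..M}"
  shows "consec_prod x y \<le> 12 * M ^ 4"
proof -
  have "x\<^sup>2 \<le> M\<^sup>2" "y\<^sup>2 \<le> M\<^sup>2" "1 \<le> M\<^sup>2" using assms by (auto intro!: power_mono)
  hence "x\<^sup>2 + y\<^sup>2 + 1 \<le> 3 * M\<^sup>2" "x\<^sup>2 + y\<^sup>2 + 2 \<le> 4 * M\<^sup>2" by linarith+
  hence "consec_prod x y \<le> (3 * M\<^sup>2) * (4 * M\<^sup>2)" unfolding consec_prod_def by (rule mult_le_mono)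
  also have "\<dots> = 12 * M ^ 4" by (simp add: power4_eq_xxxx power2_eq_square)
  finally show ?thesis .
qed

text \<open>Sum over pairs first. Only pairs whose norm is exceptional contribute; each of them
  admits at most T values of D, and each norm has at most T^2 representations. Hence the factor
  T^3.\<close>

lemma sum_large_square_divisors_le:
  fixes w T :: real
  assumes T: "\<And>n. 0 < n \<Longrightarrow> n \<le> 12 * M ^ 4 \<Longrightarrow> real (divisor_count n) \<le> T" and T0: "T \<ge> 0"
    and M: "M \<ge> 1"
  shows "(\<Sum>D | D \<in> {1..12 * M ^ 4} \<and> w < real D. real (pair_count M (D\<^sup>2))) \<le>
           T ^ 3 * real (card (exceptional_norms (2 * M\<^sup>2) w))"
proof -
  define B where "B = {1..M} \<times> {1..M}"
  define J where "J = {D. D \<in> {1..12 * M ^ 4} \<and> w < real D}"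
  define S where "S = exceptional_norms (2 * M\<^sup>2) w"
  define F where "F = (\<lambda>z. consec_prod (fst z) (snd z))"
  define E where "E = {z \<in> B. fst z ^ 2 + snd z ^ 2 \<in> S}"
  have finB: "finite B" and finJ: "finite J" and finE: "finite E"
    by (simp_all add: B_def J_def E_def)
  have M2: "1 \<le> M\<^sup>2" using M by simp
  have zB: "fst z ^ 2 + snd z ^ 2 \<in> {1..2 * M\<^sup>2}" if "z \<in> B" for z
  proof -
    have "fst z ^ 2 \<le> M\<^sup>2" "snd z ^ 2 \<le> M\<^sup>2" "1 \<le> fst z ^ 2"
      using that by (auto simp: B_def intro!: power_mono)
    thus ?thesis by (simp only: atLeastAtMost_iff) linarith
  qed
  have F: "0 < F z" "F z \<le> 12 * M ^ 4" if "z \<in> B" for z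
    using that by (auto simp: F_def B_def consec_prod_pos intro!: consec_prod_le)
  have "(\<Sum>D\<in>J. real (pair_count M (D\<^sup>2))) = (\<Sum>D\<in>J. \<Sum>z\<in>B. of_bool (D\<^sup>2 dvd F z))"
    unfolding pair_count_eq_sum B_def F_def
    by (simp only: of_nat_sum of_nat_of_bool sum.cartesian_product[of _ "{1..M}"] case_prod_unfold)
  also have "\<dots> = (\<Sum>z\<in>B. \<Sum>D\<in>J. of_bool (D\<^sup>2 dvd F z))" by (rule sum.swap)
  also have "\<dots> = (\<Sum>z\<in>B. real (card {D \<in> J. D\<^sup>2 dvd F z}))"
    using finJ by (intro sum.cong refl) (simp add: Collect_conj_eq)
  also have "\<dots> = (\<Sum>z\<in>E. real (card {D \<in> J. D\<^sup>2 dvd F z}))"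
  proof (rule sum.mono_neutral_right[OF finB])
    show "\<forall>z\<in>B - E. real (card {D \<in> J. D\<^sup>2 dvd F z}) = 0"
    proof
      fix z assume z: "z \<in> B - E"
      have "{D \<in> J. D\<^sup>2 dvd F z} = {}"
      proof (rule ccontr)
        assume "{D \<in> J. D\<^sup>2 dvd F z} \<noteq> {}"
        then obtain D where "D \<in> J" "D\<^sup>2 dvd F z" by auto
        hence "fst z ^ 2 + snd z ^ 2 \<in> S"
          using zB[of z] z unfolding S_def exceptional_norms_def J_def F_def consec_prod_def by blast
        thus False using z by (simp add: E_def)
      qed
      thus "real (card {D \<in> J. D\<^sup>2 dvd F z}) = 0" by (simp only: card.empty of_nat_0)
    qed
  qed (auto simp: E_def)
  also have "\<dots> \<le> (\<Sum>z\<in>E. T)"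
  proof (rule sum_mono)
    fix z assume "z \<in> E"
    hence z: "z \<in> B" by (simp add: E_def)
    have "card {D \<in> J. D\<^sup>2 dvd F z} \<le> divisor_count (F z)"
      unfolding divisor_count_def using F(1)[OF z]
      by (intro card_mono) (auto intro: dvd_trans[rotated])
    hence "real (card {D \<in> J. D\<^sup>2 dvd F z}) \<le> real (divisor_count (F z))" by simp
    also have "\<dots> \<le> T" using F[OF z] by (rule T)
    finally show "real (card {D \<in> J. D\<^sup>2 dvd F z}) \<le> T" .
  qed
  also have "\<dots> = T * real (card E)" by simp
  also have "real (card E) \<le> T\<^sup>2 * real (card S)"
  proof -
    have finS: "finite S" by (simp add: S_def exceptional_norms_def)
    have "E \<subseteq> (\<Union>s\<in>S. two_square_reps s)" by (auto simp: E_def B_def two_square_reps_def)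
    hence "card E \<le> card (\<Union>s\<in>S. two_square_reps s)"
      using finS finite_two_square_reps by (intro card_mono) auto
    also have "\<dots> \<le> (\<Sum>s\<in>S. card (two_square_reps s))" by (rule card_UN_le[OF finS])
    finally have "real (card E) \<le> (\<Sum>s\<in>S. real (card (two_square_reps s)))"
      unfolding of_nat_sum[symmetric] by (rule of_nat_mono)
    also have "\<dots> \<le> (\<Sum>s\<in>S. T\<^sup>2)"
    proof (rule sum_mono)
      fix s assume "s \<in> S"
      hence s: "s > 0" "s \<le> 2 * M\<^sup>2" by (auto simp: S_def exceptional_norms_def)
      have "M\<^sup>2 \<le> M ^ 4" using M by (intro power_increasing) auto
      hence "s \<le> 12 * M ^ 4" using s by linarith
      have "real (card (two_square_reps s)) \<le> real (divisor_count s ^ 2)"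
        using card_two_square_reps_le[OF s(1)] by (rule of_nat_mono)
      also have "\<dots> \<le> T\<^sup>2" using T[OF s(1) \<open>s \<le> 12 * M ^ 4\<close>] by (simp add: power_mono)
      finally show "real (card (two_square_reps s)) \<le> T\<^sup>2" .
    qed
    finally show ?thesis by (simp add: mult.commute)
  qed
  finally show ?thesis
    using T0 unfolding J_def[symmetric] S_def[symmetric]
    by (simp add: mult_left_mono power3_eq_cube power2_eq_square mult.assoc)
qed

subsection \<open>The singular series and the asymptotic formula\<close>

text \<open>The cutoff depends on \<open>M\<close> alone, so the sum over D given by
  \<open>sum_moebius_square_dvd\<close> can be moved outside the sums over x and y.\<close>

lemma Gamma_sum_eq:
  assumes M: "M = nat \<lfloor>H\<rfloor>"
  shows "Gamma_sum H = (\<Sum>D\<in>{1..12 * M ^ 4}. moebius_mu D * int (pair_count M (D\<^sup>2)))"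
proof -
  define Q where "Q = 12 * M ^ 4"
  have mu2: "(moebius_mu n)\<^sup>2 = of_bool (squarefree n)" for n
    by (simp add: moebius_mu_def power2_eq_square flip: power_mult_distrib)
  have "Gamma_sum H = (\<Sum>x\<in>{1..M}. \<Sum>y\<in>{1..M}. of_bool (squarefree (consec_prod x y)))"
    unfolding Gamma_sum_def M[symmetric] mu2 squarefree_consec_prod_iff of_bool_conj ..
  also have "\<dots> = (\<Sum>x\<in>{1..M}. \<Sum>y\<in>{1..M}. \<Sum>D\<in>{1..Q}. moebius_mu D * of_bool (D\<^sup>2 dvd consec_prod x y))"
  proof (intro sum.cong refl)
    fix x y assume xy: "x \<in> {1..M}" "y \<in> {1..M}"
    have "of_bool (squarefree (consec_prod x y)) =
          (\<Sum>D | D \<in> {1..Q} \<and> D\<^sup>2 dvd consec_prod x y. moebius_mu D)"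
      using sum_moebius_square_dvd[OF consec_prod_pos consec_prod_le[OF xy]] by (simp only: Q_def)
    also have "\<dots> = (\<Sum>D\<in>{1..Q}. if D\<^sup>2 dvd consec_prod x y then moebius_mu D else 0)"
      by (rule sum.inter_filter) simp
    also have "\<dots> = (\<Sum>D\<in>{1..Q}. moebius_mu D * of_bool (D\<^sup>2 dvd consec_prod x y))"
      by (intro sum.cong refl) simp
    finally show "of_bool (squarefree (consec_prod x y)) = \<dots>" .
  qed
  also have "\<dots> = (\<Sum>x\<in>{1..M}. \<Sum>D\<in>{1..Q}. \<Sum>y\<in>{1..M}. moebius_mu D * of_bool (D\<^sup>2 dvd consec_prod x y))"
    by (intro sum.cong refl sum.swap)
  also have "\<dots> = (\<Sum>D\<in>{1..Q}. \<Sum>x\<in>{1..M}. \<Sum>y\<in>{1..M}. moebius_mu D * of_bool (D\<^sup>2 dvd consec_prod x y))"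
    by (rule sum.swap)
  also have "\<dots> = (\<Sum>D\<in>{1..Q}. moebius_mu D * int (pair_count M (D\<^sup>2)))"
    unfolding pair_count_eq_sum by (simp only: of_nat_sum of_nat_of_bool sum_distrib_left)
  finally show ?thesis by (simp only: Q_def)
qed

text \<open>The coefficient of H^2 contributed by the divisor D. It vanishes at D = 0 and at every D
  that is not squarefree, so series and partial sums may run over all naturals.\<close>

definition sigma_term :: "nat \<Rightarrow> real" where
  "sigma_term D = real_of_int (moebius_mu D) * (real (pair_count (D\<^sup>2) (D\<^sup>2)) / real D ^ 4)"

lemma abs_moebius_mu: "\<bar>moebius_mu n\<bar> = of_bool (squarefree n)"
  by (simp add: moebius_mu_def power_abs)

lemma sigma_term_bound:
  fixes \<delta> C :: real
  assumes C: "C \<ge> 1"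
    "\<And>D. squarefree D \<Longrightarrow> real (pair_count (D\<^sup>2) (D\<^sup>2)) \<le> C * real D powr \<delta> * (real D)\<^sup>2"
  shows "\<bar>sigma_term D\<bar> \<le> C * real D powr (\<delta> - 2)"
proof (cases "squarefree D")
  case True
  hence D: "D > 0" by (auto intro!: Nat.gr0I)
  have "\<bar>sigma_term D\<bar> = real (pair_count (D\<^sup>2) (D\<^sup>2)) / real D ^ 4"
    using True by (simp add: sigma_term_def abs_mult abs_moebius_mu flip: of_int_abs)
  also have "\<dots> \<le> (C * real D powr \<delta> * (real D)\<^sup>2) / real D ^ 4"
    by (intro divide_right_mono C(2)[OF True]) simp
  also have "\<dots> = C * (real D powr \<delta> / (real D)\<^sup>2)"
    using D by (simp add: power4_eq_xxxx power2_eq_square field_simps)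
  also have "\<dots> = C * real D powr (\<delta> - 2)"
    using D by (simp add: powr_diff powr_numeral)
  finally show ?thesis .
next
  case False
  thus ?thesis using C(1) by (simp add: sigma_term_def moebius_mu_def)
qed

section \<open>The singular series as an Euler product\<close>

lemma convergent_prod_sigma_factor: "convergent_prod sigma_factor"
proof (rule abs_convergent_prod_imp_convergent_prod)
  have "summable (\<lambda>p. 8 * inverse (real p ^ 2))"
    by (intro summable_mult inverse_power_summable) simp
  hence "summable (\<lambda>p. norm (sigma_factor p - 1))"
  proof (rule summable_comparison_test')
    fix p :: nat
    show "norm (norm (sigma_factor p - 1)) \<le> 8 * inverse (real p ^ 2)"
    proof (cases "prime p")
      case True
      have "norm (norm (sigma_factor p - 1)) = real (pair_count (p\<^sup>2) (p\<^sup>2)) / real p ^ 4"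
        using True by (simp add: sigma_factor_def pair_count_prime_square)
      also have "\<dots> \<le> real (8 * p\<^sup>2) / real p ^ 4"
        using pair_count_prime_square_le[OF True] by (intro divide_right_mono of_nat_mono) auto
      also have "\<dots> = 8 * inverse (real p ^ 2)"
        using prime_gt_0_nat[OF True] by (simp add: power4_eq_xxxx power2_eq_square field_simps)
      finally show ?thesis .
    qed (simp add: sigma_factor_def)
  qed
  thus "abs_convergent_prod sigma_factor" by (simp add: abs_convergent_prod_conv_summable)
qed

lemma sigma_term_squarefree:
  assumes D: "squarefree D"
  shows "sigma_term D =
    real_of_int (moebius_mu D) * (\<Prod>p\<in>prime_factors D. real (pair_count (p\<^sup>2) (p\<^sup>2)) / real p ^ 4)"
proof -
  have "real D = (\<Prod>p\<in>prime_factors D. real p)"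
    using arg_cong[OF squarefree_eq_prod_prime_factors[OF D], of real] by simp
  hence "real D ^ 4 = (\<Prod>p\<in>prime_factors D. real p ^ 4)" by (simp only: prod_power_distrib)
  thus ?thesis
    unfolding sigma_term_def pair_count_squarefree[OF D] by (simp only: of_nat_prod prod_dividef)
qed

lemma sigma_term_sums: "sigma_term sums sigma_const"
proof -
  obtain C where C: "C \<ge> 1"
    "\<And>D. squarefree D \<Longrightarrow> real (pair_count (D\<^sup>2) (D\<^sup>2)) \<le> C * real D powr (1 / 2) * (real D)\<^sup>2"
    using pair_count_bound[of "1 / 2"] by auto
  have "summable (\<lambda>D. C * real D powr (1 / 2 - 2))"
    by (intro summable_mult) (simp add: summable_real_powr_iff)
  hence summ: "summable (\<lambda>D. norm (sigma_term D))"
    by (rule summable_comparison_test') (use sigma_term_bound[OF C] in simp)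
  define S where "S = suminf sigma_term"
  have sums: "sigma_term sums S"
    unfolding S_def using summable_norm_cancel[OF summ] by (rule summable_sums)
  hence has_sum: "(sigma_term has_sum S) UNIV" by (rule norm_summable_imp_has_sum[OF summ])
  define A where "A = (\<lambda>n::nat. {p \<in> {..n}. prime p})"
  define B where "B = (\<lambda>n. {D::nat. squarefree D \<and> prime_factors D \<subseteq> A n})"
  have A: "finite (A n)" "\<And>p. p \<in> A n \<Longrightarrow> prime p" for n by (auto simp: A_def)
  have finB: "finite (B n)" for n
    using bij_betw_finite[OF bij_betw_prime_sets_squarefree[OF A]] A by (simp add: B_def)
  have prod_eq: "(\<Prod>i\<le>n. sigma_factor i) = sum sigma_term (B n \<union> {..n})" for n
  proof -
    have "(\<Prod>i\<le>n. sigma_factor i) = (\<Prod>p\<in>A n. sigma_factor p)"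
      by (intro prod.mono_neutral_right) (auto simp: A_def sigma_factor_def)
    also have "\<dots> = (\<Prod>p\<in>A n. 1 - real (pair_count (p\<^sup>2) (p\<^sup>2)) / real p ^ 4)"
      using A(2) by (intro prod.cong refl) (simp add: sigma_factor_def pair_count_prime_square)
    also have "\<dots> = (\<Sum>D\<in>B n. real_of_int (moebius_mu D) *
        (\<Prod>p\<in>prime_factors D. real (pair_count (p\<^sup>2) (p\<^sup>2)) / real p ^ 4))"
      unfolding B_def by (rule sum_moebius_prod_eq_prod[OF A, symmetric])
    also have "\<dots> = sum sigma_term (B n)"
      by (intro sum.cong refl) (simp add: B_def sigma_term_squarefree)
    \<comment> \<open>The sets \<open>B n\<close> contain only squarefree numbers and so do not
      exhaust the naturals; with \<open>{..n}\<close> added they do. The added terms are zero, since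
      a squarefree D up to n already lies in \<open>B n\<close>.\<close>
    also have "\<dots> = sum sigma_term (B n \<union> {..n})"
    proof (rule sum.mono_neutral_left)
      show "\<forall>D\<in>B n \<union> {..n} - B n. sigma_term D = 0"
      proof
        fix D assume D: "D \<in> B n \<union> {..n} - B n"
        have "\<not> squarefree D"
        proof
          assume sf: "squarefree D"
          hence "D > 0" by (auto intro!: Nat.gr0I)
          hence "p \<le> D" if "p \<in> prime_factors D" for p
            using that by (intro dvd_imp_le in_prime_factors_imp_dvd)
          hence "prime_factors D \<subseteq> A n" using D by (fastforce simp: A_def)
          thus False using D sf by (auto simp: B_def)
        qed
        thus "sigma_term D = 0" by (simp add: sigma_term_def moebius_mu_def)
      qed
    qed (use finB in auto)
    finally show ?thesis .
  qed
  have "filterlim (\<lambda>n. B n \<union> {..n}) (finite_subsets_at_top UNIV) sequentially"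
    unfolding filterlim_finite_subsets_at_top
  proof (intro allI impI)
    fix X :: "nat set" assume X: "finite X \<and> X \<subseteq> UNIV"
    have "\<forall>\<^sub>F n in sequentially. Max (insert 0 X) \<le> n" by (rule eventually_ge_at_top)
    thus "\<forall>\<^sub>F n in sequentially. finite (B n \<union> {..n}) \<and> X \<subseteq> B n \<union> {..n} \<and> B n \<union> {..n} \<subseteq> UNIV"
      by eventually_elim (use X finB in auto)
  qed
  \<comment> \<open>Absolute convergence allows summation along any finite sets that exhaust the
    naturals.\<close>
  hence "(\<lambda>n. sum sigma_term (B n \<union> {..n})) \<longlonglongrightarrow> S"
    using filterlim_compose[OF has_sum[unfolded has_sum_def]] by blast
  moreover have "(\<lambda>n. \<Prod>i\<le>n. sigma_factor i) \<longlonglongrightarrow> sigma_const"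
    unfolding sigma_const_def by (rule convergent_prod_LIMSEQ[OF convergent_prod_sigma_factor])
  ultimately have "S = sigma_const" unfolding prod_eq by (rule LIMSEQ_unique)
  thus ?thesis using sums by simp
qed

text \<open>For m > Q, the partial sum over D < m differs from the sum over D up to w by a finite
  sum over D > w, where \<open>bnd\<close> applies; then let m tend to infinity.
  \<open>w \<le> real Q\<close> ensures that the range loses no D up to w.\<close>

lemma sigma_const_tail:
  fixes w b :: real
  assumes bnd: "\<And>A. finite A \<Longrightarrow> (\<And>D. D \<in> A \<Longrightarrow> w < real D) \<Longrightarrow> (\<Sum>D\<in>A. \<bar>sigma_term D\<bar>) \<le> b"
    and Q: "w \<le> real Q"
  shows "\<bar>(\<Sum>D | D \<in> {1..Q} \<and> real D \<le> w. sigma_term D) - sigma_const\<bar> \<le> b"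
proof (rule LIMSEQ_le_const2)
  define I where "I = {D. D \<in> {1..Q} \<and> real D \<le> w}"
  show "(\<lambda>m. \<bar>sum sigma_term I - (\<Sum>D<m. sigma_term D)\<bar>) \<longlonglongrightarrow> \<bar>sum sigma_term I - sigma_const\<bar>"
    using sigma_term_sums unfolding sums_def by (intro tendsto_intros)
  show "\<exists>N. \<forall>m\<ge>N. \<bar>sum sigma_term I - (\<Sum>D<m. sigma_term D)\<bar> \<le> b"
  proof (intro exI allI impI)
    fix m assume m: "m \<ge> Suc Q"
    define A where "A = {D \<in> {..<m}. w < real D}"
    have z: "sigma_term 0 = 0" by (simp add: sigma_term_def)
    have "(\<Sum>D<m. sigma_term D) = sum sigma_term (I \<union> A)"
    proof (rule sum.mono_neutral_right)
      show "\<forall>D\<in>{..<m} - (I \<union> A). sigma_term D = 0"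
      proof
        fix D assume D: "D \<in> {..<m} - (I \<union> A)"
        hence "real D \<le> w" by (auto simp: A_def)
        hence "D \<le> Q" using Q by linarith
        with D \<open>real D \<le> w\<close> have "D = 0" by (auto simp: I_def)
        thus "sigma_term D = 0" by (simp add: z)
      qed
    qed (use m in \<open>auto simp: I_def A_def\<close>)
    also have "\<dots> = sum sigma_term I + sum sigma_term A"
      by (rule sum.union_disjoint) (auto simp: I_def A_def)
    finally have "\<bar>sum sigma_term I - (\<Sum>D<m. sigma_term D)\<bar> = \<bar>sum sigma_term A\<bar>" by simp
    also have "\<dots> \<le> (\<Sum>D\<in>A. \<bar>sigma_term D\<bar>)" by (rule sum_abs)
    also have "\<dots> \<le> b" by (rule bnd) (auto simp: A_def)
    finally show "\<bar>sum sigma_term I - (\<Sum>D<m. sigma_term D)\<bar> \<le> b" .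
  qed
qed

section \<open>Error terms and the asymptotic formula\<close>

lemma small_square_divisors_approx:
  fixes w C \<delta> :: real
  assumes C: "C \<ge> 1"
    "\<And>D. squarefree D \<Longrightarrow> real (pair_count (D\<^sup>2) (D\<^sup>2)) \<le> C * real D powr \<delta> * (real D)\<^sup>2"
    and \<delta>: "\<delta> \<ge> 0" and w: "0 \<le> w" "w\<^sup>2 \<le> real M"
  shows "\<bar>(\<Sum>D | D \<in> {1..Q} \<and> real D \<le> w. real_of_int (moebius_mu D) * real (pair_count M (D\<^sup>2))) -
          (real M)\<^sup>2 * (\<Sum>D | D \<in> {1..Q} \<and> real D \<le> w. sigma_term D)\<bar>
          \<le> 3 * C * (real M * w powr \<delta> * w)"
proof -
  define I where "I = {D. D \<in> {1..Q} \<and> real D \<le> w}"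
  have "\<bar>(\<Sum>D\<in>I. real_of_int (moebius_mu D) * real (pair_count M (D\<^sup>2))) - (real M)\<^sup>2 * sum sigma_term I\<bar> =
        \<bar>\<Sum>D\<in>I. real_of_int (moebius_mu D) *
          (real (pair_count M (D\<^sup>2)) - (real M / real (D\<^sup>2))\<^sup>2 * real (pair_count (D\<^sup>2) (D\<^sup>2)))\<bar>"
    unfolding sum_distrib_left sum_subtractf[symmetric]
    by (intro arg_cong[where f = abs] sum.cong refl)
       (simp add: sigma_term_def power_divide algebra_simps flip: power_mult)
  \<comment> \<open>As D^2 is at most M, the full-period error 3 (M / D^2) L(D^2) is available; the
    bound on L cancels D^2. The result is uniform over the at most w values of D.\<close>
  also have "\<dots> \<le> (\<Sum>D\<in>I. 3 * C * (real M * w powr \<delta>))"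
  proof (rule order_trans[OF sum_abs sum_mono])
    fix D assume D: "D \<in> I"
    hence D0: "D > 0" and Dw: "real D \<le> w" by (auto simp: I_def)
    define R where "R = real (pair_count M (D\<^sup>2)) - (real M / real (D\<^sup>2))\<^sup>2 * real (pair_count (D\<^sup>2) (D\<^sup>2))"
    show "\<bar>real_of_int (moebius_mu D) * R\<bar> \<le> 3 * C * (real M * w powr \<delta>)"
    proof (cases "squarefree D")
      case True
      have "(real D)\<^sup>2 \<le> w\<^sup>2" using Dw by (intro power_mono) auto
      hence "real (D\<^sup>2) \<le> real M" using w(2) unfolding of_nat_power by linarith
      hence DM: "D\<^sup>2 \<le> M" by (simp only: of_nat_le_iff)
      have "\<bar>real_of_int (moebius_mu D) * R\<bar> = \<bar>R\<bar>"
        using True by (simp add: abs_mult abs_moebius_mu flip: of_int_abs)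
      also have "\<dots> \<le> 3 * (real M / real (D\<^sup>2)) * real (pair_count (D\<^sup>2) (D\<^sup>2))"
        unfolding R_def using D0 DM by (intro pair_count_approx) auto
      also have "\<dots> \<le> 3 * (real M / real (D\<^sup>2)) * (C * real D powr \<delta> * (real D)\<^sup>2)"
        by (intro mult_left_mono C(2)[OF True]) auto
      also have "\<dots> = 3 * C * (real M * real D powr \<delta>)" using D0 by simp
      also have "\<dots> \<le> 3 * C * (real M * w powr \<delta>)"
        using C(1) \<delta> Dw by (intro mult_left_mono powr_mono2) auto
      finally show ?thesis .
    next
      case False
      thus ?thesis using C(1) by (simp add: moebius_mu_def)
    qed
  qed
  also have "\<dots> = 3 * C * (real M * w powr \<delta>) * real (card I)" by simp
  also have "\<dots> \<le> 3 * C * (real M * w powr \<delta>) * w"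
  proof (rule mult_left_mono)
    have "I \<subseteq> {1..nat \<lfloor>w\<rfloor>}" using w by (auto simp: I_def le_nat_floor)
    hence "card I \<le> card {1..nat \<lfloor>w\<rfloor>}" by (intro card_mono) auto
    hence "real (card I) \<le> real (nat \<lfloor>w\<rfloor>)" by (simp only: card_atLeastAtMost diff_Suc_1 of_nat_le_iff)
    also have "\<dots> \<le> w" using w by simp
    finally show "real (card I) \<le> w" .
  qed (use C(1) in auto)
  finally show ?thesis by (simp add: I_def mult.assoc)
qed

text \<open>Up to small powers, the tail of the singular series and the large divisors cost x^2 / w,
  the small divisors x w, and the class counts w^2. With w = x^(2/5) these are x^(8/5), x^(7/5) and
  x^(4/5).\<close>

lemma moebius_pair_count_sum_estimate:
  fixes \<epsilon> :: real
  assumes \<epsilon>: "\<epsilon> > 0"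
  obtains C where "\<And>M. M \<ge> 1 \<Longrightarrow>
    \<bar>(\<Sum>D\<in>{1..12 * M ^ 4}. real_of_int (moebius_mu D) * real (pair_count M (D\<^sup>2))) - sigma_const * (real M)\<^sup>2\<bar>
      \<le> C * real M powr (8 / 5 + \<epsilon>)"
proof -
  \<comment> \<open>The final error carries x^(16\<delta>) from \<open>T ^ 4\<close> and one more
    \<delta> from \<open>V\<close>, hence 17. The cap 1/4 secures the hypothesis of
    \<open>powr_tail_bound\<close>.\<close>
  define \<delta> where "\<delta> = min (\<epsilon> / 17) (1 / 4)"
  have \<delta>: "0 < \<delta>" "\<delta> < 1 / 2" "17 * \<delta> \<le> \<epsilon>" using \<epsilon> by (auto simp: \<delta>_def)
  obtain C1 where C1: "C1 \<ge> 1"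
    "\<And>D. squarefree D \<Longrightarrow> real (pair_count (D\<^sup>2) (D\<^sup>2)) \<le> C1 * real D powr \<delta> * (real D)\<^sup>2"
    using pair_count_bound[OF \<delta>(1)] by blast
  obtain C2 where C2: "C2 \<ge> 1" "\<And>n. n > 0 \<Longrightarrow> real (divisor_count n) \<le> C2 * real n powr \<delta>"
    using divisor_bound[OF \<delta>(1)] by blast
  obtain K where K: "K \<ge> 0"
    "\<And>(w :: real) A. w > 0 \<Longrightarrow> finite A \<Longrightarrow> (\<And>d. d \<in> A \<Longrightarrow> w < real d) \<Longrightarrow>
       (\<Sum>d\<in>A. real d powr (\<delta> - 2)) \<le> K * w powr (2 * \<delta> - 1)"
    using powr_tail_bound[OF \<delta>(1,2)] by blast
  define C3 where "C3 = C2 * 12 powr \<delta>"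
  have C3: "C3 \<ge> 1" using C2(1) \<delta> unfolding C3_def by (intro mult_ge1_I ge_one_powr_ge_zero) auto
  show ?thesis
  proof (rule that)
    fix M :: nat assume M: "M \<ge> 1"
    define x where "x = real M"
    have x: "x \<ge> 1" using M by (simp add: x_def)
    define w where "w = x powr (2 / 5)"
    define Q where "Q = 12 * M ^ 4"
    define T where "T = C3 * x powr (4 * \<delta>)"
    \<comment> \<open>A common majorant for all error terms before the divisor factors; the tail
      produces the exponent 8/5 + 4\<delta>/5.\<close>
    define V where "V = x powr (8 / 5 + \<delta>)"
    have w: "1 \<le> w" using x unfolding w_def by (intro ge_one_powr_ge_zero) auto
    have w2: "w\<^sup>2 = x powr (4 / 5)"
      using x by (simp add: w_def powr_powr flip: powr_numeral)
    have w2x: "w\<^sup>2 \<le> x" using powr_mono[of "4 / 5" 1 x] x by (simp add: w2)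
    have wx: "w \<le> x" using powr_mono[of "2 / 5" 1 x] x by (simp add: w_def)
    have MQ: "M \<le> Q"
    proof -
      have "M ^ 1 \<le> M ^ 4" using M by (intro power_increasing) auto
      thus ?thesis by (simp add: Q_def)
    qed
    have T1: "T \<ge> 1" unfolding T_def using C3 x \<delta> by (intro mult_ge1_I ge_one_powr_ge_zero) auto
    have T: "real (divisor_count n) \<le> T" if "0 < n" "n \<le> Q" for n
    proof -
      have "real n \<le> real (12 * M ^ 4)" using that(2) unfolding Q_def by (rule of_nat_mono)
      hence nx: "real n \<le> 12 * x ^ 4" by (simp add: x_def)
      have "real (divisor_count n) \<le> C2 * real n powr \<delta>" by (rule C2(2)[OF that(1)])
      also have "\<dots> \<le> C2 * (12 * x ^ 4) powr \<delta>"
        using nx \<delta> C2(1) by (intro mult_left_mono powr_mono2) auto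
      also have "\<dots> = C3 * (x ^ 4) powr \<delta>" using x by (simp add: powr_mult C3_def)
      also have "(x ^ 4) powr \<delta> = x powr (4 * \<delta>)"
        using x by (simp add: powr_powr flip: powr_numeral)
      finally show ?thesis by (simp add: T_def)
    qed
    have tail: "(\<Sum>d\<in>A. 1 / (real d)\<^sup>2) \<le> K * w powr (2 * \<delta> - 1)"
      if "finite A" "\<And>d. d \<in> A \<Longrightarrow> w < real d" for A
    proof -
      have "(\<Sum>d\<in>A. 1 / (real d)\<^sup>2) \<le> (\<Sum>d\<in>A. real d powr (\<delta> - 2))"
      proof (rule sum_mono)
        fix d assume "d \<in> A"
        hence d: "real d > 1" using that(2) w by force
        have "1 / (real d)\<^sup>2 = real d powr (-2)"
          using d by (simp add: powr_minus powr_numeral inverse_eq_divide)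
        also have "\<dots> \<le> real d powr (\<delta> - 2)" using d \<delta> by (intro powr_mono) auto
        finally show "1 / (real d)\<^sup>2 \<le> real d powr (\<delta> - 2)" .
      qed
      also have "\<dots> \<le> K * w powr (2 * \<delta> - 1)" using that w by (intro K(2)) auto
      finally show ?thesis .
    qed
    define I where "I = {D. D \<in> {1..Q} \<and> real D \<le> w}"
    define J where "J = {D. D \<in> {1..Q} \<and> w < real D}"
    define f where "f = (\<lambda>D. real_of_int (moebius_mu D) * real (pair_count M (D\<^sup>2)))"

    have pow_w: "x\<^sup>2 * w powr (2 * \<delta> - 1) \<le> V"
    proof -
      have "x\<^sup>2 * w powr (2 * \<delta> - 1) = x powr (2 + 2 / 5 * (2 * \<delta> - 1))"
        using x by (simp add: w_def powr_powr powr_add powr_numeral)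
      also have "\<dots> \<le> V" unfolding V_def using x \<delta>
        by (intro powr_mono) (auto simp: field_simps)
      finally show ?thesis .
    qed

    have small: "\<bar>sum f I - x\<^sup>2 * sum sigma_term I\<bar> \<le> 3 * C1 * V"
    proof -
      have "\<bar>sum f I - x\<^sup>2 * sum sigma_term I\<bar> \<le> 3 * C1 * (x * w powr \<delta> * w)"
        unfolding f_def I_def x_def
        by (rule small_square_divisors_approx[OF C1]) (use \<delta> w w2x in \<open>auto simp: x_def\<close>)
      also have "x * w powr \<delta> * w = x powr (1 + 2 / 5 * \<delta> + 2 / 5)"
      proof -
        have "x powr (1 + 2 / 5 * \<delta> + 2 / 5) = x powr 1 * x powr (2 / 5 * \<delta>) * x powr (2 / 5)"
          by (simp only: powr_add)
        thus ?thesis using x by (simp add: w_def powr_powr)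
      qed
      also have "\<dots> \<le> V" unfolding V_def using x \<delta> by (intro powr_mono) auto
      finally show ?thesis using C1(1) by (simp add: mult_left_mono)
    qed

    have series: "\<bar>sum sigma_term I - sigma_const\<bar> \<le> C1 * (K * w powr (2 * \<delta> - 1))"
      unfolding I_def
    proof (rule sigma_const_tail)
      fix A assume A: "finite A" "\<And>D. D \<in> A \<Longrightarrow> w < real D"
      have "(\<Sum>D\<in>A. \<bar>sigma_term D\<bar>) \<le> (\<Sum>D\<in>A. C1 * real D powr (\<delta> - 2))"
        by (intro sum_mono sigma_term_bound[OF C1])
      also have "\<dots> = C1 * (\<Sum>D\<in>A. real D powr (\<delta> - 2))" by (simp add: sum_distrib_left)
      also have "\<dots> \<le> C1 * (K * w powr (2 * \<delta> - 1))"
        using A w C1(1) by (intro mult_left_mono K(2)) auto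
      finally show "(\<Sum>D\<in>A. \<bar>sigma_term D\<bar>) \<le> C1 * (K * w powr (2 * \<delta> - 1))" .
    next
      have "x \<le> real Q" using MQ by (simp add: x_def)
      thus "w \<le> real Q" using wx by linarith
    qed
    have series': "\<bar>x\<^sup>2 * sum sigma_term I - sigma_const * x\<^sup>2\<bar> \<le> C1 * K * V"
    proof -
      have "\<bar>x\<^sup>2 * sum sigma_term I - sigma_const * x\<^sup>2\<bar> = x\<^sup>2 * \<bar>sum sigma_term I - sigma_const\<bar>"
        by (simp add: abs_mult left_diff_distrib mult.commute[of "x\<^sup>2"] flip: abs_mult)
           (simp add: abs_mult flip: left_diff_distrib)
      also have "\<dots> \<le> x\<^sup>2 * (C1 * (K * w powr (2 * \<delta> - 1)))"
        using series by (intro mult_left_mono) auto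
      also have "\<dots> = (C1 * K) * (x\<^sup>2 * w powr (2 * \<delta> - 1))" by simp
      also have "\<dots> \<le> (C1 * K) * V" using C1(1) K(1) pow_w by (intro mult_left_mono) auto
      finally show ?thesis .
    qed

    \<comment> \<open>Three factors T come from passing from pairs to norms, the fourth from
      counting the exceptional norms.\<close>
    have large: "\<bar>sum f J\<bar> \<le> T ^ 4 * ((10 * K + 1) * V)"
    proof -
      have "\<bar>sum f J\<bar> \<le> (\<Sum>D\<in>J. \<bar>f D\<bar>)" by (rule sum_abs)
      also have "\<dots> \<le> (\<Sum>D\<in>J. real (pair_count M (D\<^sup>2)))"
        unfolding f_def by (intro sum_mono) (simp add: abs_mult abs_moebius_mu flip: of_int_abs)
      also have "\<dots> \<le> T ^ 3 * real (card (exceptional_norms (2 * M\<^sup>2) w))"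
        unfolding J_def Q_def
        by (rule sum_large_square_divisors_le) (use T T1 M in \<open>auto simp: Q_def\<close>)
      also have "\<dots> \<le> T ^ 3 * (T * ((10 * K + 1) * V))"
      proof (rule mult_left_mono)
        define s where "s = x\<^sup>2 * (K * w powr (2 * \<delta> - 1))"
        have "real (card (exceptional_norms (2 * M\<^sup>2) w)) \<le>
          8 * x\<^sup>2 * (\<Sum>d | d \<in> {1..2 * M} \<and> w < real d. 1 / (real d)\<^sup>2) +
          T * (2 * x\<^sup>2 * (\<Sum>D | D \<in> {1..nat \<lfloor>w\<^sup>2\<rfloor>} \<and> w < real D. 1 / (real D)\<^sup>2) + w\<^sup>2)"
          unfolding x_def
        proof (rule card_exceptional_norms_le[OF M w])
          fix D :: nat assume D: "0 < D" "real D \<le> w\<^sup>2"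
          have "real D \<le> real M" using D(2) w2x by (simp add: x_def)
          hence "D \<le> Q" using MQ by simp
          thus "real (divisor_count D) \<le> T" using T D(1) by blast
        qed
        also have "\<dots> \<le> 8 * x\<^sup>2 * (K * w powr (2 * \<delta> - 1)) +
          T * (2 * x\<^sup>2 * (K * w powr (2 * \<delta> - 1)) + w\<^sup>2)"
          using T1 by (intro add_mono mult_left_mono tail) auto
        also have "\<dots> = 8 * s + T * (2 * s + w\<^sup>2)" by (simp add: s_def mult.assoc)
        \<comment> \<open>\<open>T \<ge> 1\<close> lets the first sum share the factor T, so that
          everything collects into T (10 s + w^2).\<close>
        also have "\<dots> \<le> T * (8 * s) + T * (2 * s + w\<^sup>2)"
        proof -
          have "0 \<le> 8 * s" using K(1) by (simp add: s_def)
          hence "1 * (8 * s) \<le> T * (8 * s)" using T1 by (intro mult_right_mono)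
          thus ?thesis by simp
        qed
        also have "\<dots> = T * (10 * s + w\<^sup>2)" by (simp add: algebra_simps)
        also have "\<dots> \<le> T * (10 * (K * V) + V)"
        proof (intro mult_left_mono add_mono)
          have "K * (x\<^sup>2 * w powr (2 * \<delta> - 1)) \<le> K * V" using K(1) pow_w by (intro mult_left_mono)
          thus "s \<le> K * V" by (simp add: s_def mult_ac)
          show "w\<^sup>2 \<le> V" unfolding w2 V_def using x \<delta> by (intro powr_mono) auto
        qed (use T1 in auto)
        finally show "real (card (exceptional_norms (2 * M\<^sup>2) w)) \<le> T * ((10 * K + 1) * V)"
          by (simp add: algebra_simps)
      qed (use T1 in auto)
      finally show ?thesis by (simp add: power4_eq_xxxx power3_eq_cube mult.assoc)
    qed

    have "sum f {1..Q} = sum f I + sum f J"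
      by (subst sum.union_disjoint[symmetric]) (auto simp: I_def J_def intro!: sum.cong)
    hence "\<bar>sum f {1..Q} - sigma_const * x\<^sup>2\<bar> \<le> 3 * C1 * V + C1 * K * V + T ^ 4 * ((10 * K + 1) * V)"
      using small series' large by linarith
    also have "\<dots> = (3 * C1 + C1 * K) * V + C3 ^ 4 * (10 * K + 1) * (x powr (16 * \<delta>) * V)"
    proof -
      have "T ^ 4 = C3 ^ 4 * x powr (16 * \<delta>)"
        using x by (simp add: T_def power_mult_distrib powr_power)
      thus ?thesis by (simp add: algebra_simps)
    qed
    also have "\<dots> \<le> (3 * C1 + C1 * K) * x powr (8 / 5 + \<epsilon>) + C3 ^ 4 * (10 * K + 1) * x powr (8 / 5 + \<epsilon>)"
    proof (intro add_mono mult_left_mono)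
      show "V \<le> x powr (8 / 5 + \<epsilon>)" unfolding V_def using x \<delta> by (intro powr_mono) auto
      have "x powr (16 * \<delta>) * V = x powr (8 / 5 + 17 * \<delta>)"
        unfolding V_def by (simp add: add.commute flip: powr_add)
      also have "\<dots> \<le> x powr (8 / 5 + \<epsilon>)" using x \<delta> by (intro powr_mono) auto
      finally show "x powr (16 * \<delta>) * V \<le> x powr (8 / 5 + \<epsilon>)" .
    qed (use C1(1) K(1) C3 in auto)
    finally show "\<bar>(\<Sum>D\<in>{1..12 * M ^ 4}. real_of_int (moebius_mu D) * real (pair_count M (D\<^sup>2))) -
        sigma_const * (real M)\<^sup>2\<bar>
      \<le> (3 * C1 + C1 * K + C3 ^ 4 * (10 * K + 1)) * real M powr (8 / 5 + \<epsilon>)"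
      by (simp add: f_def Q_def x_def algebra_simps)
  qed
qed

theorem theorem1:
  shows "convergent_prod sigma_factor \<and>
         (\<forall>\<epsilon>::real. \<epsilon> > 0 \<longrightarrow>
            (\<lambda>H::real. real_of_int (Gamma_sum H) - sigma_const * H\<^sup>2)
              \<in> O[at_top](\<lambda>H. H powr (8 / 5 + \<epsilon>)))"
proof (intro conjI allI impI)
  show "convergent_prod sigma_factor" by (rule convergent_prod_sigma_factor)
  fix \<epsilon> :: real assume \<epsilon>: "\<epsilon> > 0"
  obtain C where C: "\<And>M. M \<ge> 1 \<Longrightarrow>
    \<bar>(\<Sum>D\<in>{1..12 * M ^ 4}. real_of_int (moebius_mu D) * real (pair_count M (D\<^sup>2))) - sigma_const * (real M)\<^sup>2\<bar>
      \<le> C * real M powr (8 / 5 + \<epsilon>)"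
    using moebius_pair_count_sum_estimate[OF \<epsilon>] by blast
  have C0: "C \<ge> 0" using order_trans[OF abs_ge_zero C[of 1]] by simp
  show "(\<lambda>H. real_of_int (Gamma_sum H) - sigma_const * H\<^sup>2) \<in> O[at_top](\<lambda>H. H powr (8 / 5 + \<epsilon>))"
  proof (rule bigoI)
    show "\<forall>\<^sub>F H in at_top. norm (real_of_int (Gamma_sum H) - sigma_const * H\<^sup>2)
            \<le> (C + 2 * \<bar>sigma_const\<bar>) * norm (H powr (8 / 5 + \<epsilon>))"
      using eventually_ge_at_top[of 1]
    proof eventually_elim
      fix H :: real assume H: "H \<ge> 1"
      define M where "M = nat \<lfloor>H\<rfloor>"
      have M: "M \<ge> 1" "real M \<le> H" "H < real M + 1"
        using H by (auto simp: M_def le_nat_floor)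
      have G: "real_of_int (Gamma_sum H) =
          (\<Sum>D\<in>{1..12 * M ^ 4}. real_of_int (moebius_mu D) * real (pair_count M (D\<^sup>2)))"
        by (simp add: Gamma_sum_eq[OF M_def])
      have "\<bar>real_of_int (Gamma_sum H) - sigma_const * (real M)\<^sup>2\<bar> \<le> C * real M powr (8 / 5 + \<epsilon>)"
        unfolding G by (rule C[OF M(1)])
      also have "\<dots> \<le> C * H powr (8 / 5 + \<epsilon>)"
        using C0 M \<epsilon> by (intro mult_left_mono powr_mono2) auto
      finally have 1: "\<bar>real_of_int (Gamma_sum H) - sigma_const * (real M)\<^sup>2\<bar> \<le> \<dots>" .
      \<comment> \<open>Passing from the integer part back to H costs at most 2 H in the square,
        below the error term since its exponent exceeds 1.\<close>
      have "\<bar>sigma_const * (real M)\<^sup>2 - sigma_const * H\<^sup>2\<bar> = \<bar>sigma_const\<bar> * \<bar>(real M)\<^sup>2 - H\<^sup>2\<bar>"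
        by (simp flip: abs_mult right_diff_distrib)
      also have "\<bar>(real M)\<^sup>2 - H\<^sup>2\<bar> \<le> 2 * H powr (8 / 5 + \<epsilon>)"
      proof -
        have "\<bar>(real M)\<^sup>2 - H\<^sup>2\<bar> = (H - real M) * (H + real M)"
          using M H power_mono[of "real M" H 2] by (simp add: power2_eq_square algebra_simps)
        also have "\<dots> \<le> 1 * (2 * H)" using M H by (intro mult_mono) auto
        also have "H \<le> H powr (8 / 5 + \<epsilon>)"
          using powr_mono[of 1 "8 / 5 + \<epsilon>" H] H \<epsilon> by simp
        finally show ?thesis by simp
      qed
      finally have 2: "\<bar>sigma_const * (real M)\<^sup>2 - sigma_const * H\<^sup>2\<bar>
          \<le> \<bar>sigma_const\<bar> * (2 * H powr (8 / 5 + \<epsilon>))"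
        by (simp add: mult_left_mono)
      from 1 2 show "norm (real_of_int (Gamma_sum H) - sigma_const * H\<^sup>2)
            \<le> (C + 2 * \<bar>sigma_const\<bar>) * norm (H powr (8 / 5 + \<epsilon>))"
        by (simp add: algebra_simps)
    qed
  qed
qed

end
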